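(* Let $K$ be a perfect field, let $P=K[x_1,\dots,x_n]$, and let $I$ be a zero-dimensional ideal in $P$. The following procedure terminates and returns the radical $\sqrt{I}$ of $I$. 1. Let $J=I$ and compute $d=\dim_K(P/J)$. 2. For $i=1,\dots,n$ do: 2.1. compute $\mu=\mu_{x_i,J}$; 2.2. if $\mu$ is not square-free then: (2.2.1) let $\mu=\mathrm{sqfree}(\mu)$; (2.2.2) let $J=J+\langle\mu(x_i)\rangle$; (2.2.3) compute $d=\dim_K(P/J)$; 2.3. if $\deg(\mu)=d$ then return $J$. 3. Return $J$.
   Context: An ideal $I$ of $P$ is zero-dimensional if $P/I$ is non-zero and finite-dimensional over $K$. For $f\in P$ and a zero-dimensional ideal $J$, the minimal polynomial $\mu_{f,J}(z)\in K[z]$ is the monic generator of the kernel of the $K$-algebra homomorphism $K[z]\to P/J$, $z\mapsto f\bmod J$. For a polynomial $g$ of positive degree, $\mathrm{sqfree}(g)$ is the product of all distinct irreducible factors of $g$ (defined up to a constant factor). In characteristic $p>0$, the field $K$ is assumed to have effective $p$-th roots (so that square-free parts can be computed); the basic operations in the procedure are assumed to be computable. *)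

theory Defs
  imports
    "HOL-Algebra.Embedded_Algebras"
    "HOL-Algebra.QuotRing"
    "HOL-Computational_Algebra.Polynomial"
    "HOL-Computational_Algebra.Squarefree"
    "HOL-Library.Poly_Mapping"
begin

definition perfect_field :: "'a::field itself \<Rightarrow> bool" where
  "perfect_field _ \<longleftrightarrow> CHAR('a) = 0 \<or> surj (\<lambda>x::'a. x ^ CHAR('a))"

text \<open>
  A polynomial is a finitely supported map from monomials to coefficients, where a monomial is a
  finitely supported map from variable indices to exponents. The ring \<open>K[x\<^sub>1,\<dots>,x\<^sub>n]\<close> consists
  of the polynomials in which only the indices \<open>1,\<dots>,n\<close> occur.
\<close>

type_synonym 'a mpoly = "(nat \<Rightarrow>\<^sub>0 nat) \<Rightarrow>\<^sub>0 'a"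

definition Const :: "'a \<Rightarrow> 'a::field mpoly" where
  "Const c = Poly_Mapping.single 0 c"

definition X :: "nat \<Rightarrow> 'a::field mpoly" where
  "X i = Poly_Mapping.single (Poly_Mapping.single i 1) 1"

definition mpoly_ring :: "nat \<Rightarrow> 'a::field mpoly ring" where
  "mpoly_ring n =
     \<lparr>carrier = {f. \<forall>m\<in>Poly_Mapping.keys f. Poly_Mapping.keys m \<subseteq> {1..n}},
      monoid.mult = (*), one = 1, ring.zero = 0, add = (+)\<rparr>"

lemma cring_mpoly_ring: "cring (mpoly_ring n)"
proof (rule cringI)
  show "abelian_group (mpoly_ring n :: 'a mpoly ring)"
  proof (rule abelian_groupI)
    fix f :: "'a mpoly" assume f: "f \<in> carrier (mpoly_ring n)"
    have "- f \<in> carrier (mpoly_ring n)"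
      using f by (auto simp: mpoly_ring_def in_keys_iff)
    then show "\<exists>g\<in>carrier (mpoly_ring n). g \<oplus>\<^bsub>mpoly_ring n\<^esub> f = \<zero>\<^bsub>mpoly_ring n\<^esub>"
      by (intro bexI[of _ "- f"]) (auto simp: mpoly_ring_def)
  qed (use Poly_Mapping.keys_add in \<open>fastforce simp: mpoly_ring_def add_ac\<close>)+
  show "comm_monoid (mpoly_ring n :: 'a mpoly ring)"
  proof (rule comm_monoidI)
    fix f g :: "'a mpoly"
    assume f: "f \<in> carrier (mpoly_ring n)" and g: "g \<in> carrier (mpoly_ring n)"
    have "Poly_Mapping.keys m \<subseteq> {1..n}" if "m \<in> Poly_Mapping.keys (f * g)" for m
    proof -
      from that obtain a b where ab: "m = a + b" "a \<in> Poly_Mapping.keys f" "b \<in> Poly_Mapping.keys g"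
        using keys_mult[of f g] by auto
      have "Poly_Mapping.keys m \<subseteq> Poly_Mapping.keys a \<union> Poly_Mapping.keys b"
        unfolding ab by (rule Poly_Mapping.keys_add)
      moreover have "Poly_Mapping.keys a \<subseteq> {1..n}" "Poly_Mapping.keys b \<subseteq> {1..n}"
        using ab f g by (auto simp: mpoly_ring_def)
      ultimately show ?thesis by blast
    qed
    then show "f \<otimes>\<^bsub>mpoly_ring n\<^esub> g \<in> carrier (mpoly_ring n)"
      by (auto simp: mpoly_ring_def)
  qed (auto simp: mpoly_ring_def mult_ac)
qed (auto simp: mpoly_ring_def algebra_simps)

definition quot_scalars :: "nat \<Rightarrow> 'a::field mpoly set \<Rightarrow> 'a mpoly set set" where
  "quot_scalars n J = range (\<lambda>c. J +>\<^bsub>mpoly_ring n\<^esub> Const c)"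

text \<open>
  \<open>d = dim\<^sub>K (P/J)\<close>, with \<open>K\<close> acting through its image in \<open>P/J\<close>. This is a relation, so it holds
  for no \<open>d\<close> if \<open>P/J\<close> is infinite-dimensional.
\<close>

definition quot_dim :: "nat \<Rightarrow> 'a::field mpoly set \<Rightarrow> nat \<Rightarrow> bool" where
  "quot_dim n J d \<longleftrightarrow>
     ring.dimension (mpoly_ring n Quot J) d (quot_scalars n J) (carrier (mpoly_ring n Quot J))"

definition zero_dimensional :: "nat \<Rightarrow> 'a::field mpoly set \<Rightarrow> bool" where
  "zero_dimensional n I \<longleftrightarrow>
     ideal I (mpoly_ring n) \<and>
     carrier (mpoly_ring n Quot I) \<noteq> {\<zero>\<^bsub>mpoly_ring n Quot I\<^esub>} \<and>
     (\<exists>d. quot_dim n I d)"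

definition radical :: "('b, 'c) ring_scheme \<Rightarrow> 'b set \<Rightarrow> 'b set" where
  "radical R I = {f \<in> carrier R. \<exists>k::nat. k > 0 \<and> f [^]\<^bsub>R\<^esub> k \<in> I}"

definition subst :: "'a::field poly \<Rightarrow> 'a mpoly \<Rightarrow> 'a mpoly" where
  "subst g f = poly (map_poly Const g) f"

definition eval_kernel :: "nat \<Rightarrow> 'a::field mpoly \<Rightarrow> 'a mpoly set \<Rightarrow> 'a poly set" where
  "eval_kernel n f J =
     {g. J +>\<^bsub>mpoly_ring n\<^esub> subst g f = \<zero>\<^bsub>mpoly_ring n Quot J\<^esub>}"

definition is_minpoly :: "nat \<Rightarrow> 'a::field mpoly \<Rightarrow> 'a mpoly set \<Rightarrow> 'a poly \<Rightarrow> bool" where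
  "is_minpoly n f J \<mu> \<longleftrightarrow> lead_coeff \<mu> = 1 \<and> eval_kernel n f J = range (\<lambda>q. \<mu> * q)"

text \<open>
  The square-free part is only determined up to a nonzero constant, so it is a relation. Monic
  polynomials represent the irreducible factors up to associates.
\<close>

definition is_sqfree :: "'a::field poly \<Rightarrow> 'a poly \<Rightarrow> bool" where
  "is_sqfree g h \<longleftrightarrow>
     (\<exists>c. c \<noteq> 0 \<and>
       h = smult c (\<Prod>{q. Factorial_Ring.irreducible q \<and> lead_coeff q = 1 \<and> q dvd g}))"

text \<open>
  The procedure as a transition system. A configuration records the control point together with
  the current values of the program variables. The computed quantities are given by relations, so
  a run gets stuck before \<open>Return\<close> if one of them does not exist.
\<close>

datatype ('p, 'u) config =
    Start "'p set"
  | Loop nat "'p set" nat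
  | Test_Sqfree nat "'p set" nat 'u
  | Test_Degree nat "'p set" nat 'u
  | Return "'p set"

inductive step :: "nat \<Rightarrow> ('a::field mpoly, 'a poly) config \<Rightarrow> ('a mpoly, 'a poly) config \<Rightarrow> bool" for n where
  init:
    "quot_dim n I d \<Longrightarrow> step n (Start I) (Loop 1 I d)"
| loop_end:
    "i > n \<Longrightarrow> step n (Loop i J d) (Return J)"
| loop_minpoly:
    "i \<le> n \<Longrightarrow> is_minpoly n (X i) J \<mu> \<Longrightarrow> step n (Loop i J d) (Test_Sqfree i J d \<mu>)"
| already_sqfree:
    "squarefree \<mu> \<Longrightarrow> step n (Test_Sqfree i J d \<mu>) (Test_Degree i J d \<mu>)"
| make_sqfree:
    "\<not> squarefree \<mu> \<Longrightarrow> is_sqfree \<mu> \<nu> \<Longrightarrow>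
     J' = J <+>\<^bsub>mpoly_ring n\<^esub> Idl\<^bsub>mpoly_ring n\<^esub> {subst \<nu> (X i)} \<Longrightarrow> quot_dim n J' d' \<Longrightarrow>
     step n (Test_Sqfree i J d \<mu>) (Test_Degree i J' d' \<nu>)"
| early_return:
    "Polynomial.degree \<mu> = d \<Longrightarrow> step n (Test_Degree i J d \<mu>) (Return J)"
| loop_next:
    "Polynomial.degree \<mu> \<noteq> d \<Longrightarrow> step n (Test_Degree i J d \<mu>) (Loop (Suc i) J d)"

end

theory Submission
  imports Defs "HOL-Algebra.Algebraic_Closure_Type"
begin

text \<open>
  During a run the current ideal \<open>J\<close> satisfies \<open>I \<subseteq> J \<subseteq> \<surd>I\<close>, and \<open>P/J\<close> stays finite-dimensional.
  The only change of \<open>J\<close> adjoins \<open>\<nu>(x\<^sub>i)\<close>, where \<open>\<nu>\<close> is the square-free part of the minimal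
  polynomial \<open>\<mu>\<close> of \<open>x\<^sub>i\<close>. As \<open>\<mu>\<close> divides a power of \<open>\<nu>\<close>, this stays inside the radical, and the
  minimal polynomial of \<open>x\<^sub>i\<close> modulo the new ideal is \<open>\<nu>\<close> (\<open>adjoin_sqfree_part\<close>). So it remains to
  see that a returned \<open>J\<close> is a radical ideal. There are two exits.

  If \<open>deg \<mu> = dim (P/J)\<close> for a square-free \<open>\<mu>\<close>, then the powers of \<open>x\<^sub>i\<close> span \<open>P/J\<close>, which is
  therefore \<open>K[z]/(\<mu>)\<close> and reduced (\<open>radical_if_generated_by_squarefree\<close>).

  At the end of the loop, \<open>J\<close> contains a square-free polynomial \<open>g\<^sub>i(x\<^sub>i)\<close> for every \<open>i\<close>. By
  Seidenberg's criterion \<open>J\<close> is then radical (\<open>radical_if_squarefree_univariate\<close>). Over a perfect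
  field a square-free polynomial is comaximal with its derivative
  (\<open>squarefree_comaximal_pderiv\<close>) and hence remains square-free over the algebraic closure. There
  it splits into distinct linear factors, and passing to colon ideals fixes the value of one
  variable after another until \<open>J\<close> describes a single point
  (\<open>radical_if_squarefree_univariate_alg_closed\<close>). The result descends to \<open>K\<close> because an
  ideal of \<open>P\<close> is recovered from its extension by a \<open>K\<close>-linear retraction of the closure onto \<open>K\<close>,
  applied to the coefficients (\<open>lift_ac_mem_ac_ideal_iff\<close>).

  Finally no run gets stuck before returning: \<open>x\<^sub>i\<close> has a minimal polynomial since its powers are
  dependent in the finite-dimensional \<open>P/J\<close>, and enlarging \<open>J\<close> keeps the quotient
  finite-dimensional (\<open>exists_minpoly\<close>, \<open>quot_dim_superideal\<close>).
\<close>

hide_const (open) Polynomials.lead_coeff Polynomials.degree Divisibility.irreducible Divisibility.prime UnivPoly.coeff UnivPoly.monom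
  Formal_Power_Series.radical
no_notation Polynomials.var (\<open>X\<index>\<close>)

section \<open>Univariate polynomials over a field\<close>

lemma poly_ideal_principal:
  fixes S :: "'a::field poly set"
  assumes "0 \<in> S" and add: "\<And>f g. f \<in> S \<Longrightarrow> g \<in> S \<Longrightarrow> f + g \<in> S"
    and mult: "\<And>f g. g \<in> S \<Longrightarrow> f * g \<in> S" and "S \<noteq> {0}"
  obtains \<mu> where "lead_coeff \<mu> = 1" "S = range (\<lambda>q. \<mu> * q)"
proof -
  have "\<exists>h. h \<in> S \<and> h \<noteq> 0" using assms(1,4) by blast
  then obtain h where h: "h \<in> S" "h \<noteq> 0"
    and min: "\<And>f. f \<in> S \<Longrightarrow> f \<noteq> 0 \<Longrightarrow> degree h \<le> degree f"
    using ex_has_least_nat[of "\<lambda>h. h \<in> S \<and> h \<noteq> 0" _ degree] by metis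
  define \<mu> where "\<mu> = smult (inverse (lead_coeff h)) h"
  have "lead_coeff \<mu> = 1" using h by (simp add: \<mu>_def)
  moreover have "\<mu> * q \<in> S" for q
    using mult[OF h(1), of "smult (inverse (lead_coeff h)) q"] by (simp add: \<mu>_def mult.commute)
  moreover have "f \<in> range (\<lambda>q. \<mu> * q)" if "f \<in> S" for f
  proof -
    have "f mod h = f + (- (f div h)) * h"
      by (simp add: minus_div_mult_eq_mod[symmetric])
    then have "f mod h \<in> S" using add[OF that mult[OF h(1)]] by metis
    then have "f mod h = 0" using min[of "f mod h"] degree_mod_less'[OF h(2), of f] by force
    then have "f = h * (f div h)" by (simp add: mod_eq_0_iff_dvd)
    also have "\<dots> = \<mu> * smult (lead_coeff h) (f div h)" using h(2) by (simp add: \<mu>_def)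
    finally show ?thesis by blast
  qed
  ultimately show thesis using that by blast
qed

lemma exists_irreducible_factor:
  fixes p :: "'a::field poly"
  assumes "p \<noteq> 0" "\<not> p dvd 1"
  obtains q where "irreducible q" "lead_coeff q = 1" "q dvd p"
proof -
  have "\<exists>q. irreducible q \<and> q dvd p"
    using assms
  proof (induction "degree p" arbitrary: p rule: less_induct)
    case less
    show ?case
    proof (cases "irreducible p")
      case False
      then obtain a b where ab: "p = a * b" "\<not> a dvd 1" "\<not> b dvd 1"
        using less.prems by (auto simp: Factorial_Ring.irreducible_def)
      then have "a \<noteq> 0" "b \<noteq> 0" using less.prems by auto
      moreover have "degree b > 0"
        using ab(3) \<open>b \<noteq> 0\<close> by (simp add: is_unit_iff_degree)
      ultimately have "degree a < degree p"
        using ab(1) by (simp add: degree_mult_eq)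
      from less.hyps[OF this \<open>a \<noteq> 0\<close> ab(2)] show ?thesis using ab(1) by auto
    qed auto
  qed
  then obtain q where q: "irreducible q" "q dvd p" by blast
  define c where "c = inverse (lead_coeff q)"
  have "c \<noteq> 0" using q(1) by (auto simp: c_def)
  then have "is_unit [:c:]" by (simp add: is_unit_const_poly_iff dvd_field_iff)
  then have "irreducible ([:c:] * q)"
    using q(1) irreducible_mult_unit_left by blast
  moreover have "[:c:] * q dvd p" using q(2) \<open>c \<noteq> 0\<close> by (simp add: smult_dvd_iff)
  moreover have "lead_coeff ([:c:] * q) = 1" using q(1) by (auto simp: c_def)
  ultimately show thesis using that by blast
qed

lemma bezout_if_no_common_irreducible_factor:
  fixes a b :: "'a::field poly"
  assumes "a \<noteq> 0" and no: "\<And>q. irreducible q \<Longrightarrow> q dvd a \<Longrightarrow> q dvd b \<Longrightarrow> False"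
  obtains u v where "u * a + v * b = 1"
proof -
  define S where "S = {u * a + v * b |u v. True}"
  have "1 * a + 0 * b \<in> S" "0 * a + 1 * b \<in> S" "0 * a + 0 * b \<in> S"
    unfolding S_def by blast+
  then have a: "a \<in> S" and b: "b \<in> S" and "0 \<in> S" by simp_all
  have "S \<noteq> {0}" using a \<open>a \<noteq> 0\<close> by auto
  obtain h where "lead_coeff h = 1" and h: "S = range (\<lambda>q. h * q)"
  proof (rule poly_ideal_principal[OF \<open>0 \<in> S\<close> _ _ \<open>S \<noteq> {0}\<close>])
    fix f g assume "f \<in> S" "g \<in> S"
    then obtain u v u' v' where "f = u * a + v * b" "g = u' * a + v' * b" by (auto simp: S_def)
    then have "f + g = (u + u') * a + (v + v') * b" by (simp add: algebra_simps)
    then show "f + g \<in> S" by (auto simp: S_def)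
  next
    fix f g assume "g \<in> S"
    then obtain u v where "g = u * a + v * b" by (auto simp: S_def)
    then have "f * g = (f * u) * a + (f * v) * b" by (simp add: algebra_simps)
    then show "f * g \<in> S" by (auto simp: S_def)
  qed
  have "h dvd a" "h dvd b" using a b h by auto
  have "h dvd 1"
  proof (rule ccontr)
    assume "\<not> h dvd 1"
    moreover have "h \<noteq> 0" using \<open>lead_coeff h = 1\<close> by auto
    ultimately obtain q where "irreducible q" "q dvd h"
      using exists_irreducible_factor by metis
    then show False using no \<open>h dvd a\<close> \<open>h dvd b\<close> dvd_trans by blast
  qed
  then have "1 \<in> S" using h by (auto simp: dvd_def)
  then show thesis using that by (auto simp: S_def)
qed

text \<open>
  A factorization of \<open>m\<close> has at most \<open>deg m\<close> irreducible factors, counted with multiplicity, and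
  each of them divides \<open>w\<close>.
\<close>

lemma dvd_power_if_irreducible_factors_dvd:
  fixes m w :: "'a::field poly"
  assumes "m \<noteq> 0" "\<And>q. irreducible q \<Longrightarrow> lead_coeff q = 1 \<Longrightarrow> q dvd m \<Longrightarrow> q dvd w"
  shows "m dvd w ^ degree m"
  using assms
proof (induction "degree m" arbitrary: m rule: less_induct)
  case less
  show ?case
  proof (cases "m dvd 1")
    case True
    then show ?thesis using dvd_trans one_dvd by blast
  next
    case False
    obtain q where q: "irreducible q" "lead_coeff q = 1" "q dvd m"
      using exists_irreducible_factor[OF less.prems(1) False] .
    then obtain r where r: "m = q * r" by blast
    have "r \<noteq> 0" "q \<noteq> 0" using less.prems(1) r by auto
    have "degree q > 0"
      using irreducible_not_unit[OF q(1)] \<open>q \<noteq> 0\<close> by (simp add: is_unit_iff_degree)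
    then have deg: "Suc (degree r) \<le> degree m"
      using r \<open>r \<noteq> 0\<close> \<open>q \<noteq> 0\<close> by (simp add: degree_mult_eq)
    have "r dvd w ^ degree r"
      using less.hyps[of r] deg \<open>r \<noteq> 0\<close> less.prems(2) r by auto
    then have "m dvd w ^ Suc (degree r)"
      using less.prems(2)[OF q] r by (simp add: mult_dvd_mono)
    then show ?thesis by (rule dvd_trans[OF _ le_imp_power_dvd[OF deg]])
  qed
qed

text \<open>
  Induction on the degree: if \<open>m = q r\<close> with \<open>q\<close> irreducible, then \<open>w = r s\<close> by induction, and the
  prime \<open>q\<close> divides \<open>s\<close> because it cannot divide \<open>r\<close> a second time.
\<close>

lemma squarefree_dvd_if_irreducible_factors_dvd:
  fixes m w :: "'a::field poly"
  assumes "squarefree m" "\<And>q. irreducible q \<Longrightarrow> q dvd m \<Longrightarrow> q dvd w"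
  shows "m dvd w"
  using assms
proof (induction "degree m" arbitrary: m rule: less_induct)
  case less
  have "m \<noteq> 0" using less.prems(1) by auto
  show ?case
  proof (cases "m dvd 1")
    case True
    then show ?thesis using dvd_trans one_dvd by blast
  next
    case False
    obtain q where q: "irreducible q" "q dvd m"
      using exists_irreducible_factor[OF \<open>m \<noteq> 0\<close> False] by metis
    then obtain r where r: "m = q * r" by blast
    have "r \<noteq> 0" "q \<noteq> 0" using \<open>m \<noteq> 0\<close> r by auto
    have "degree q > 0"
      using irreducible_not_unit[OF q(1)] \<open>q \<noteq> 0\<close> by (simp add: is_unit_iff_degree)
    then have deg: "degree r < degree m"
      using r \<open>r \<noteq> 0\<close> \<open>q \<noteq> 0\<close> by (simp add: degree_mult_eq)
    have "r dvd w"
      using less.hyps[OF deg] less.prems r squarefree_mono[of r m] by auto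
    then obtain s where s: "w = r * s" by blast
    have "\<not> q dvd r"
      using squarefreeD[OF less.prems(1), of q] irreducible_not_unit[OF q(1)]
      by (auto simp: r power2_eq_square)
    then have "q dvd s"
      using less.prems(2)[OF q] s field_poly_irreducible_imp_prime[OF q(1)]
      by (simp add: prime_elem_dvd_mult_iff)
    then show ?thesis by (auto simp: r s)
  qed
qed

lemma squarefree_dvd_power_imp_dvd:
  fixes m w :: "'a::field poly"
  assumes "squarefree m" "m dvd w ^ k"
  shows "m dvd w"
proof (rule squarefree_dvd_if_irreducible_factors_dvd[OF assms(1)])
  fix q assume "irreducible q" "q dvd m"
  then show "q dvd w"
    using prime_elem_dvd_power[OF field_poly_irreducible_imp_prime dvd_trans[OF _ assms(2)]] by blast
qed

lemma monic_irreducible_dvd_eq: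
  fixes p q :: "'a::field poly"
  assumes "irreducible p" "irreducible q" "lead_coeff p = 1" "lead_coeff q = 1" "p dvd q"
  shows "p = q"
proof -
  obtain r where r: "q = p * r" using assms(5) by blast
  then have "r dvd 1" using assms(1,2) by (auto simp: Factorial_Ring.irreducible_def)
  then obtain c where "r = [:c:]" by (auto elim: is_unit_polyE)
  then show ?thesis using r assms(3,4) by (simp split: if_splits)
qed

text \<open>
  Being monic makes distinct irreducible polynomials non-associated, so that no prime factor is
  repeated in their product.
\<close>

lemma prod_monic_irreducible:
  fixes F :: "'a::field poly set"
  assumes "finite F" "\<And>q. q \<in> F \<Longrightarrow> irreducible q \<and> lead_coeff q = 1"
  shows "squarefree (\<Prod>F)" "(\<And>q. q \<in> F \<Longrightarrow> q dvd w) \<Longrightarrow> \<Prod>F dvd w"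
proof -
  have F: "squarefree (\<Prod>F) \<and>
      (\<forall>q. irreducible q \<longrightarrow> lead_coeff q = 1 \<longrightarrow> q dvd \<Prod>F \<longrightarrow> q \<in> F)"
    using assms
  proof (induction F rule: finite_induct)
    case empty
    then show ?case by (auto dest: irreducible_not_unit)
  next
    case (insert p F)
    have p: "irreducible p" "lead_coeff p = 1" using insert.prems by auto
    have IH: "squarefree (\<Prod>F)"
      "\<And>q. irreducible q \<Longrightarrow> lead_coeff q = 1 \<Longrightarrow> q dvd \<Prod>F \<Longrightarrow> q \<in> F"
      using insert.IH[OF insert.prems[OF insertI2]] by blast+
    have np: "\<not> p dvd \<Prod>F" using IH(2)[OF p] insert.hyps by blast
    have mem: "q \<in> insert p F"
      if q: "irreducible q" "lead_coeff q = 1" "q dvd p * \<Prod>F" for q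
      using prime_elem_dvd_mult_iff[OF field_poly_irreducible_imp_prime[OF q(1)]] that(3)
        monic_irreducible_dvd_eq[OF q(1) p(1) q(2) p(2)] IH(2)[OF q(1,2)] by auto
    have "squarefree (p * \<Prod>F)"
    proof (rule squarefreeI, rule ccontr)
      fix x assume x: "x\<^sup>2 dvd p * \<Prod>F" "\<not> x dvd 1"
      have "x \<noteq> 0" using x(1) np p(1) by (auto simp: power2_eq_square)
      then obtain q where q: "irreducible q" "lead_coeff q = 1" "q dvd x"
        using exists_irreducible_factor[OF _ x(2)] by blast
      have q2: "q * q dvd p * \<Prod>F"
        using dvd_trans[OF mult_dvd_mono[OF q(3) q(3)]] x(1) by (simp add: power2_eq_square)
      show False
      proof (cases "q = p")
        case True
        then have "p dvd \<Prod>F" using q2 p(1) by auto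
        then show False using np by blast
      next
        case False
        then have "\<not> q dvd p" using monic_irreducible_dvd_eq[OF q(1) p(1) q(2) p(2)] by blast
        have *: "prime_elem q" using field_poly_irreducible_imp_prime q(1) .
        have "q dvd \<Prod>F"
          using prime_elem_dvd_mult_iff[OF *] dvd_mult_left[OF q2] \<open>\<not> q dvd p\<close> by blast
        then obtain r where r: "\<Prod>F = q * r" by blast
        have "q * q dvd q * (p * r)" using q2 r by (simp add: mult.left_commute)
        then have "q dvd p * r" using q(1) by auto
        then have "q dvd r" using prime_elem_dvd_mult_iff[OF *] \<open>\<not> q dvd p\<close> by blast
        then have "q ^ 2 dvd \<Prod>F" using r by (simp add: power2_eq_square)
        then show False using squarefreeD[OF IH(1)] irreducible_not_unit[OF q(1)] by blast
      qed
    qed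
    then show ?case using mem insert.hyps by simp
  qed
  then show "squarefree (\<Prod>F)" by blast
  assume w: "\<And>q. q \<in> F \<Longrightarrow> q dvd w"
  show "\<Prod>F dvd w"
  proof (rule squarefree_dvd_if_irreducible_factors_dvd)
    show "squarefree (\<Prod>F)" using F by blast
    fix q assume q: "irreducible q" "q dvd \<Prod>F"
    then have "prime_elem q" using field_poly_irreducible_imp_prime by blast
    moreover have "q dvd prod_mset (mset_set F)"
      using q(2) by (simp add: prod_unfold_prod_mset)
    ultimately obtain p where "p \<in> F" "q dvd p"
      using assms(1) by (auto elim: prime_elem_dvd_prod_msetE)
    then show "q dvd w" using w dvd_trans by blast
  qed
qed

text \<open>
  The product of any finite set of such factors divides \<open>m\<close>, and each of them has positive
  degree, so the size of the set is at most \<open>deg m\<close>.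
\<close>

lemma finite_monic_irreducible_factors:
  fixes m :: "'a::field poly"
  assumes "m \<noteq> 0"
  shows "finite {q. irreducible q \<and> lead_coeff q = 1 \<and> q dvd m}" (is "finite ?F")
proof (rule finite_if_finite_subsets_card_bdd[THEN conjunct1])
  fix G assume G: "G \<subseteq> ?F" "finite G"
  have "\<Prod>G dvd m" using prod_monic_irreducible(2)[of G m] G by blast
  then have "degree (\<Prod>G) \<le> degree m" using assms by (rule dvd_imp_degree_le)
  moreover have "degree (\<Prod>G) = (\<Sum>q\<in>G. degree q)"
    using G by (intro degree_prod_eq_sum_degree) auto
  moreover have "degree q \<ge> 1" if "q \<in> G" for q
  proof -
    have "irreducible q" using G that by auto
    then have "\<not> q dvd 1" "q \<noteq> 0" by (auto dest: irreducible_not_unit)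
    then show ?thesis by (simp add: is_unit_iff_degree)
  qed
  then have "(\<Sum>q\<in>G. degree q) \<ge> card G" using sum_mono[of G "\<lambda>_. 1" degree] by simp
  ultimately show "card G \<le> degree m" by linarith
qed

lemma is_sqfree_properties:
  fixes g h :: "'a::field poly"
  assumes "g \<noteq> 0" "is_sqfree g h"
  shows "squarefree h" "h dvd g" "\<exists>k. g dvd h ^ k"
proof -
  define F where "F = {q. irreducible q \<and> lead_coeff q = 1 \<and> q dvd g}"
  obtain c where c: "c \<noteq> 0" "h = smult c (\<Prod>F)"
    using assms(2) by (auto simp: is_sqfree_def F_def)
  have fin: "finite F" unfolding F_def by (rule finite_monic_irreducible_factors[OF assms(1)])
  have F: "\<And>q. q \<in> F \<Longrightarrow> irreducible q \<and> lead_coeff q = 1" by (auto simp: F_def)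
  have "h dvd \<Prod>F" using c by (simp add: smult_dvd_iff)
  then show "squarefree h" using prod_monic_irreducible(1)[OF fin F] squarefree_mono by blast
  have "\<Prod>F dvd g" using prod_monic_irreducible(2)[OF fin F] by (auto simp: F_def)
  then show "h dvd g" using \<open>h dvd \<Prod>F\<close> dvd_trans by blast
  have "q dvd h" if "q \<in> F" for q
    using dvd_prodI[OF fin that, of "\<lambda>q. q"] c dvd_smult by auto
  then show "\<exists>k. g dvd h ^ k"
    using dvd_power_if_irreducible_factors_dvd[OF assms(1), of h] by (auto simp: F_def)
qed

text \<open>
  If \<open>q' = 0\<close>, only exponents divisible by \<open>p\<close> occur in \<open>q\<close>, and in a perfect field their
  coefficients are \<open>p\<close>-th powers, so \<open>q\<close> is a \<open>p\<close>-th power by the Frobenius endomorphism.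
\<close>

lemma pderiv_irreducible_nonzero:
  fixes q :: "'a::field poly"
  assumes perf: "perfect_field TYPE('a)" and irr: "irreducible q"
  shows "pderiv q \<noteq> 0"
proof
  assume d0: "pderiv q = 0"
  have nu: "\<not> q dvd 1" "q \<noteq> 0" using irreducible_not_unit[OF irr] irr by auto
  then have deg: "degree q > 0" by (simp add: is_unit_iff_degree)
  define p where "p = CHAR('a)"
  have coeff0: "coeff q k = 0" if "\<not> p dvd k" for k
  proof (cases k)
    case 0
    then show ?thesis using that by simp
  next
    case (Suc j)
    have "of_nat (Suc j) * coeff q (Suc j) = 0"
      using coeff_pderiv[of q j] d0 by simp
    moreover have "(of_nat (Suc j) :: 'a) \<noteq> 0"
      using that Suc unfolding p_def of_nat_eq_0_iff_char_dvd by simp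
    ultimately show ?thesis using Suc by (metis mult_eq_0_iff)
  qed
  have "p > 0"
  proof (rule ccontr)
    assume "\<not> p > 0"
    then have "coeff q (degree q) = 0" using coeff0 deg by simp
    then show False using nu(2) by simp
  qed
  then have prime: "prime p" unfolding p_def by (rule prime_CHAR_semidom)
  have "surj (\<lambda>x::'a. x ^ p)"
    using perf \<open>p > 0\<close> unfolding perfect_field_def p_def by simp
  then have "\<exists>y. y ^ p = x" for x :: 'a using surjD[of "\<lambda>x. x ^ p" x] by auto
  then obtain root where root: "\<And>x::'a. root x ^ p = x" by metis
  define s where "s = (\<Sum>i\<le>degree q. monom (root (coeff q (p * i))) i)"
  have "s ^ p = (\<Sum>i\<le>degree q. monom (root (coeff q (p * i))) i ^ p)"
    unfolding s_def by (rule freshmans_dream_sum) (use prime in \<open>simp_all add: p_def\<close>)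
  also have "\<dots> = (\<Sum>i\<le>degree q. monom (coeff q (p * i)) (p * i))"
    by (simp add: monom_power root mult.commute)
  also have "\<dots> = q"
  proof (rule poly_eqI)
    fix k
    show "coeff (\<Sum>i\<le>degree q. monom (coeff q (p * i)) (p * i)) k
        = coeff q k" (is "?l = _")
    proof (cases "p dvd k")
      case False
      then have "?l = 0" by (auto simp: coeff_sum coeff_monom intro!: sum.neutral)
      then show ?thesis using coeff0[OF False] by simp
    next
      case True
      then obtain j where j: "k = p * j" by blast
      have "?l = (\<Sum>i\<le>degree q. if i = j then coeff q (p * i) else 0)"
        using \<open>p > 0\<close> by (auto simp: coeff_sum coeff_monom j intro!: sum.cong)
      also have "\<dots> = (if j \<le> degree q then coeff q (p * j) else 0)"
        by (simp add: sum.delta)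
      also have "\<dots> = coeff q (p * j)"
      proof -
        have "j \<le> p * j" using \<open>p > 0\<close> by simp
        then have "coeff q (p * j) = 0" if "\<not> j \<le> degree q"
          using that by (intro coeff_eq_0) linarith
        then show ?thesis by auto
      qed
      finally show ?thesis using j by simp
    qed
  qed
  finally have q: "q = s * s ^ (p - 1)" using \<open>p > 0\<close> by (simp add: power_eq_if)
  then have "s dvd 1 \<or> s ^ (p - 1) dvd 1" using Factorial_Ring.irreducibleD[OF irr] by blast
  moreover have "p - 1 > 0" using prime_gt_1_nat[OF prime] by simp
  ultimately have "s dvd 1" by (auto simp: is_unit_power_iff)
  then have "q dvd 1" using q by (metis is_unit_mult_iff is_unit_power_iff)
  then show False using nu by blast
qed

text \<open>
  A common irreducible factor \<open>q\<close> of \<open>g = q r\<close> and \<open>g'\<close> divides \<open>q' r\<close>, hence divides \<open>q'\<close>, which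
  is non-zero and of smaller degree. The resulting Bezout identity is the form of squarefreeness
  that survives field extensions.
\<close>

lemma squarefree_comaximal_pderiv:
  fixes g :: "'a::field poly"
  assumes perf: "perfect_field TYPE('a)" and sq: "squarefree g"
  obtains u v where "u * g + v * pderiv g = 1"
proof (rule bezout_if_no_common_irreducible_factor)
  show "g \<noteq> 0" using sq by auto
  fix q assume q: "irreducible q" "q dvd g" "q dvd pderiv g"
  then obtain r where r: "g = q * r" by blast
  have pr: "prime_elem q" using field_poly_irreducible_imp_prime[OF q(1)] .
  have "\<not> q dvd r"
    using squarefreeD[OF sq, of q] irreducible_not_unit[OF q(1)] by (auto simp: r power2_eq_square)
  moreover have "q dvd pderiv q * r"
    using q(3) by (auto simp: r pderiv_mult dvd_add_right_iff mult.commute)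
  ultimately have "q dvd pderiv q" using prime_elem_dvd_mult_iff[OF pr] by blast
  moreover have "degree q > 0"
    using irreducible_not_unit[OF q(1)] q(1) by (metis is_unit_iff_degree not_gr0 not_irreducible_zero)
  then have "degree (pderiv q) < degree q"
    by (intro le_less_trans[OF degree_le[of "degree q - 1"]]) (auto simp: coeff_pderiv coeff_eq_0)
  ultimately show False
    using dvd_imp_degree_le[OF _ pderiv_irreducible_nonzero[OF perf q(1)], of q] by simp
qed

section \<open>Ideals of the polynomial ring\<close>

lemma mpoly_ring_ops [simp]:
  "x \<otimes>\<^bsub>mpoly_ring n\<^esub> y = x * y" "\<one>\<^bsub>mpoly_ring n\<^esub> = 1"
  "x \<oplus>\<^bsub>mpoly_ring n\<^esub> y = x + y" "\<zero>\<^bsub>mpoly_ring n\<^esub> = 0"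
  by (simp_all add: mpoly_ring_def)

lemma mpoly_nat_pow [simp]: "f [^]\<^bsub>mpoly_ring n\<^esub> (k::nat) = f ^ k"
  by (induction k) (simp_all add: nat_pow_def mult.commute)

lemma ring_mpoly: "ring (mpoly_ring n)"
  using cring_mpoly_ring cring.axioms(1) by blast

lemma mpoly_uminus [simp]:
  assumes "f \<in> carrier (mpoly_ring n)"
  shows "\<ominus>\<^bsub>mpoly_ring n\<^esub> f = - f" "- f \<in> carrier (mpoly_ring n)"
proof -
  show "- f \<in> carrier (mpoly_ring n)"
    using assms by (auto simp: mpoly_ring_def in_keys_iff)
  then show "\<ominus>\<^bsub>mpoly_ring n\<^esub> f = - f"
    using assms by (intro abelian_group.minus_equality[OF ring.is_abelian_group[OF ring_mpoly]]) simp_all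
qed

lemma mpoly_closed [simp, intro]:
  assumes "f \<in> carrier (mpoly_ring n)" "g \<in> carrier (mpoly_ring n)"
  shows "f + g \<in> carrier (mpoly_ring n)" "f * g \<in> carrier (mpoly_ring n)" "f - g \<in> carrier (mpoly_ring n)"
proof -
  show add: "f + g \<in> carrier (mpoly_ring n)" and "f * g \<in> carrier (mpoly_ring n)"
    using ring.ring_simprules(1,5)[OF ring_mpoly, of f n g] assms by simp_all
  show "f - g \<in> carrier (mpoly_ring n)"
    using ring.ring_simprules(1)[OF ring_mpoly, of f n "- g"] assms by simp
qed

lemma mpoly_zero_one_closed [simp]: "0 \<in> carrier (mpoly_ring n)" "1 \<in> carrier (mpoly_ring n)"
  using ring.ring_simprules(2,6)[OF ring_mpoly, of n] by simp_all

lemma mpoly_power_closed [simp]: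
  "f \<in> carrier (mpoly_ring n) \<Longrightarrow> f ^ k \<in> carrier (mpoly_ring n)"
  by (induction k) simp_all

lemma Const_closed [simp]: "Const c \<in> carrier (mpoly_ring n)"
  by (auto simp: mpoly_ring_def Const_def)

lemma X_closed [simp]: "i \<in> {1..n} \<Longrightarrow> X i \<in> carrier (mpoly_ring n)"
  by (auto simp: mpoly_ring_def X_def)

lemma Const_hom [simp]:
  fixes a b :: "'a::field"
  shows "Const (0::'a) = 0" "Const (1::'a) = 1" "Const (a + b) = Const a + Const b"
    "Const (a * b) = Const a * Const b" "Const (- a) = - Const a"
  by (simp_all add: Const_def mult_single single_add single_uminus)

lemma Const_power [simp]: "Const (a ^ k) = Const a ^ k"
  by (induction k) simp_all

lemma Const_inverse: "c \<noteq> 0 \<Longrightarrow> Const (inverse c) * Const c = 1"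
  by (simp flip: Const_hom(4))

lemma subst_simps [simp]:
  "subst 0 f = 0" "subst (pCons c p) f = Const c + f * subst p f" "subst 1 f = 1"
  by (simp_all add: subst_def map_poly_pCons one_pCons)

lemma subst_add [simp]: "subst (p + q) f = subst p f + subst q f"
proof (induction p arbitrary: q)
  case (pCons a p)
  then show ?case by (cases q) (simp add: algebra_simps)
qed simp

lemma subst_diff [simp]: "subst (p - q) f = subst p f - subst q f"
  using subst_add[of "p - q" q f] by (simp add: eq_diff_eq)

lemma subst_smult [simp]: "subst (smult c p) f = Const c * subst p f"
  by (induction p) (simp_all add: algebra_simps)

lemma subst_mult [simp]: "subst (p * q) f = subst p f * subst q f"
  by (induction p) (simp_all add: algebra_simps)

lemma subst_power [simp]: "subst (p ^ k) f = subst p f ^ k"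
  by (induction k) simp_all

lemma subst_closed [simp]:
  "f \<in> carrier (mpoly_ring n) \<Longrightarrow> subst p f \<in> carrier (mpoly_ring n)"
  by (induction p) simp_all

lemma poly_mapping_induct_single [case_names zero add]:
  assumes "P 0" "\<And>m c f. m \<notin> Poly_Mapping.keys f \<Longrightarrow> c \<noteq> 0 \<Longrightarrow> P f \<Longrightarrow> P (Poly_Mapping.single m c + f)"
  shows "P f"
proof (induction f rule: update_induct)
  case (update f a b)
  have "Poly_Mapping.update a b f = Poly_Mapping.single a b + f"
    using update(1) by (intro poly_mapping_eqI) (auto simp: update.rep_eq lookup_add lookup_single when_def in_keys_iff)
  then show ?case using assms(2) update by metis
qed (rule assms(1))

lemma mpoly_induct [consumes 1, case_names Const X add mult]:
  assumes f: "f \<in> carrier (mpoly_ring n)"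
    and Const: "\<And>c. P (Const c)" and X: "\<And>i. i \<in> {1..n} \<Longrightarrow> P (X i)"
    and add: "\<And>f g. f \<in> carrier (mpoly_ring n) \<Longrightarrow> g \<in> carrier (mpoly_ring n) \<Longrightarrow> P f \<Longrightarrow> P g \<Longrightarrow> P (f + g)"
    and mult: "\<And>f g. f \<in> carrier (mpoly_ring n) \<Longrightarrow> g \<in> carrier (mpoly_ring n) \<Longrightarrow> P f \<Longrightarrow> P g \<Longrightarrow> P (f * g)"
  shows "P f"
proof -
  have pow: "P (X i ^ k)" if "i \<in> {1..n}" for i k
  proof (induction k)
    case 0
    show ?case using Const[of 1] by simp
  next
    case (Suc k)
    then show ?case using mult X[OF that] that by simp
  qed
  have X_pow: "Poly_Mapping.single (Poly_Mapping.single i k) 1 = (X i ^ k :: 'a mpoly)" for i k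
  proof (induction k)
    case (Suc k)
    have "Poly_Mapping.single i (Suc k) = Poly_Mapping.single i 1 + Poly_Mapping.single i k"
      by (simp flip: single_add)
    moreover have "X i ^ Suc k = (X i * Poly_Mapping.single (Poly_Mapping.single i k) 1 :: 'a mpoly)"
      using Suc by simp
    ultimately show ?case by (simp add: X_def mult_single)
  qed simp
  have mon: "P (Poly_Mapping.single m 1)" if "Poly_Mapping.keys m \<subseteq> {1..n}" for m
    using that
  proof (induction m rule: poly_mapping_induct_single)
    case zero
    show ?case using Const[of 1] by (simp add: Const_def)
  next
    case (add i k m)
    have keys: "Poly_Mapping.keys (Poly_Mapping.single i k + m) = insert i (Poly_Mapping.keys m)"
      using add(1,2) by (auto simp: in_keys_iff lookup_add lookup_single when_def split: if_splits)
    have "P (X i ^ k * Poly_Mapping.single m 1)"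
    proof (rule mult)
      show "Poly_Mapping.single m 1 \<in> carrier (mpoly_ring n)"
        using add.prems keys by (auto simp: mpoly_ring_def)
    qed (use add keys pow in auto)
    then show ?case by (simp add: X_pow[symmetric] mult_single)
  qed
  show ?thesis using f
  proof (induction f rule: poly_mapping_induct_single)
    case zero
    show ?case using Const[of 0] by simp
  next
    case (add m c f)
    have keys: "Poly_Mapping.keys (Poly_Mapping.single m c + f) = insert m (Poly_Mapping.keys f)"
      using add(1,2) by (auto simp: in_keys_iff lookup_add lookup_single when_def split: if_splits)
    then have m: "Poly_Mapping.keys m \<subseteq> {1..n}" and f: "f \<in> carrier (mpoly_ring n)"
      using add.prems by (auto simp: mpoly_ring_def)
    have m': "Poly_Mapping.single m 1 \<in> carrier (mpoly_ring n :: 'a mpoly ring)"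
      using m by (auto simp: mpoly_ring_def)
    have "P (Const c * Poly_Mapping.single m 1)" using mult[OF Const_closed m' Const mon[OF m]] .
    then have "P (Const c * Poly_Mapping.single m 1 + f)"
      using assms(4)[OF _ f _ add.IH[OF f], of "Const c * Poly_Mapping.single m 1"] m' by simp
    then show ?case by (simp add: Const_def mult_single)
  qed
qed

lemma ideal_mpoly_iff:
  "ideal J (mpoly_ring n) \<longleftrightarrow> J \<subseteq> carrier (mpoly_ring n) \<and> 0 \<in> J \<and>
     (\<forall>f\<in>J. \<forall>g\<in>J. f + g \<in> J) \<and> (\<forall>h\<in>carrier (mpoly_ring n). \<forall>f\<in>J. h * f \<in> J)"
    (is "_ \<longleftrightarrow> ?R")
proof
  assume J: "ideal J (mpoly_ring n)"
  then interpret J: ideal J "mpoly_ring n" .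
  show ?R
    using J.Icarr J.additive_subgroup_axioms additive_subgroup.zero_closed[of J "mpoly_ring n"]
      additive_subgroup.a_closed[OF J.additive_subgroup_axioms] J.I_l_closed by auto
next
  assume R: ?R
  show "ideal J (mpoly_ring n)"
  proof (rule idealI[OF ring_mpoly])
    show "subgroup J (add_monoid (mpoly_ring n))"
    proof (rule group.subgroupI)
      show "group (add_monoid (mpoly_ring n))"
        using abelian_group.a_group[OF ring.is_abelian_group[OF ring_mpoly]] .
      fix f assume f: "f \<in> J"
      then have "f \<in> carrier (mpoly_ring n)" "Const (- 1) * f \<in> J" using R Const_closed by blast+
      then show "inv\<^bsub>add_monoid (mpoly_ring n)\<^esub> f \<in> J"
        using mpoly_uminus(1)[of f n] by (simp add: a_inv_def)
    qed (use R in auto)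
    fix f h :: "'a mpoly" assume "f \<in> J" "h \<in> carrier (mpoly_ring n)"
    then have "h * f \<in> J" using R by blast
    then show "h \<otimes>\<^bsub>mpoly_ring n\<^esub> f \<in> J" "f \<otimes>\<^bsub>mpoly_ring n\<^esub> h \<in> J"
      by (simp_all add: mult.commute)
  qed
qed

lemma mpoly_idealD:
  assumes "ideal J (mpoly_ring n)"
  shows "0 \<in> J" "f \<in> J \<Longrightarrow> f \<in> carrier (mpoly_ring n)"
    "f \<in> J \<Longrightarrow> g \<in> J \<Longrightarrow> f + g \<in> J"
    "h \<in> carrier (mpoly_ring n) \<Longrightarrow> f \<in> J \<Longrightarrow> h * f \<in> J"
    "f \<in> J \<Longrightarrow> g \<in> J \<Longrightarrow> f - g \<in> J"
proof -
  note R = assms[unfolded ideal_mpoly_iff]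
  show "0 \<in> J" "f \<in> J \<Longrightarrow> f \<in> carrier (mpoly_ring n)"
    "h \<in> carrier (mpoly_ring n) \<Longrightarrow> f \<in> J \<Longrightarrow> h * f \<in> J"
    using R by blast+
  show add: "f \<in> J \<Longrightarrow> g \<in> J \<Longrightarrow> f + g \<in> J" for f g using R by blast
  assume "f \<in> J" "g \<in> J"
  moreover from this have "Const (- 1) * g \<in> J" using R Const_closed by blast
  ultimately show "f - g \<in> J" using add[of f "Const (- 1) * g"] by simp
qed

lemma power_diff_in_ideal:
  assumes J: "ideal J (mpoly_ring n)"
    and "f \<in> carrier (mpoly_ring n)" "g \<in> carrier (mpoly_ring n)" "f - g \<in> J"
  shows "f ^ k - g ^ k \<in> J"
proof (induction k)
  case 0
  show ?case using mpoly_idealD(1)[OF J] by simp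
next
  case (Suc k)
  have "f * (f ^ k - g ^ k) + g ^ k * (f - g) \<in> J"
    using mpoly_idealD(3)[OF J] mpoly_idealD(4)[OF J] Suc assms by simp
  then show ?case by (simp add: algebra_simps)
qed

section \<open>Separable univariate elements over an algebraically closed field\<close>

definition colon :: "nat \<Rightarrow> 'a::field mpoly set \<Rightarrow> 'a mpoly \<Rightarrow> 'a mpoly set" where
  "colon n J l = {h \<in> carrier (mpoly_ring n). l * h \<in> J}"

lemma ideal_colon:
  assumes J: "ideal J (mpoly_ring n)" and "l \<in> carrier (mpoly_ring n)"
  shows "ideal (colon n J l) (mpoly_ring n)" "J \<subseteq> colon n J l"
proof -
  note R = mpoly_idealD[OF J]
  show "ideal (colon n J l) (mpoly_ring n)"
    using R(1,3,4) by (auto simp: ideal_mpoly_iff colon_def distrib_left mult.left_commute)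
  show "J \<subseteq> colon n J l" using R(2,4) assms(2) by (auto simp: colon_def)
qed

text \<open>
  Modulo \<open>J\<close> every polynomial is congruent to a constant, its value at the point \<open>a\<close>. If this
  constant is non-zero and a power of it lies in \<open>J\<close>, then \<open>J\<close> is the whole ring.
\<close>

lemma radical_at_point:
  assumes J: "ideal J (mpoly_ring n)"
    and pt: "\<And>i. i \<in> {1..n} \<Longrightarrow> \<exists>a. X i - Const a \<in> J"
    and f: "f \<in> carrier (mpoly_ring n)" "f ^ k \<in> J"
  shows "f \<in> J"
proof -
  note R = mpoly_idealD[OF J]
  from f(1) have "\<exists>c. f - Const c \<in> J"
  proof (induction f rule: mpoly_induct)
    case (Const c)
    show ?case using R(1) by (auto intro!: exI[of _ c])
  next
    case (X i)
    then show ?case using pt by blast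
  next
    case (add f g)
    then obtain a b where "f - Const a \<in> J" "g - Const b \<in> J" by blast
    then have "(f - Const a) + (g - Const b) \<in> J" by (rule R(3))
    then have "f + g - Const (a + b) \<in> J" by (simp add: algebra_simps)
    then show ?case by blast
  next
    case (mult f g)
    then obtain a b where "f - Const a \<in> J" "g - Const b \<in> J" by blast
    then have "g * (f - Const a) + Const a * (g - Const b) \<in> J"
      using mult by (intro R(3,4)) simp_all
    then have "f * g - Const (a * b) \<in> J" by (simp add: algebra_simps)
    then show ?case by blast
  qed
  then obtain c where c: "f - Const c \<in> J" by blast
  have "f ^ k - Const c ^ k \<in> J" by (rule power_diff_in_ideal[OF J f(1) _ c]) simp
  then have "f ^ k - (f ^ k - Const c ^ k) \<in> J" by (rule R(5)[OF f(2)])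
  then have ck: "Const (c ^ k) \<in> J" by simp
  show ?thesis
  proof (cases "c ^ k = 0")
    case True
    then show ?thesis using c by simp
  next
    case False
    have "f * Const (inverse (c ^ k)) * Const (c ^ k) \<in> J" using R(4)[OF _ ck] f(1) by simp
    then show ?thesis using Const_inverse[OF False] by (simp add: mult.assoc del: Const_power)
  qed
qed

text \<open>
  The set \<open>S\<close> contains the variables whose value is not yet fixed by \<open>J\<close>. A root \<open>b\<close> of \<open>g\<close>, with
  \<open>g = (z - b) r\<close>, splits the problem for \<open>J\<close> into two colon ideals: \<open>J : r(x)\<close> contains
  \<open>x - b\<close>, and \<open>J : (x - b)\<close> contains \<open>r(x)\<close>, of smaller degree. Since \<open>r(b) \<noteq> 0\<close>, the
  polynomials \<open>z - b\<close> and \<open>r\<close> are comaximal, and the results for both colon ideals combine.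
\<close>

lemma radical_if_squarefree_univariate_alg_closed:
  fixes J :: "'b::alg_closed_field mpoly set"
  assumes "finite S" "S \<subseteq> {1..n}" "f \<in> carrier (mpoly_ring n)"
    and "ideal J (mpoly_ring n)"
    and "\<And>i. i \<in> {1..n} - S \<Longrightarrow> \<exists>a. X i - Const a \<in> J"
    and "\<And>i. i \<in> S \<Longrightarrow> \<exists>g. squarefree g \<and> subst g (X i) \<in> J"
    and "f ^ k \<in> J"
  shows "f \<in> J"
  using assms
proof (induction S arbitrary: J rule: finite_induct)
  case empty
  show ?case
    by (rule radical_at_point[OF empty.prems(3) _ empty.prems(2,6)]) (use empty.prems(4) in blast)
next
  case (insert i S)
  have i: "X i \<in> carrier (mpoly_ring n :: 'b mpoly ring)" using insert.prems(1) by simp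
  note f = insert.prems(2)
  obtain g where "squarefree g" "subst g (X i) \<in> J" using insert.prems(5) by blast
  then show ?case using insert.prems(3,4,5,6)
  proof (induction "degree g" arbitrary: g J rule: less_induct)
    case less
    note R = mpoly_idealD[OF less.prems(3)]
    have "g \<noteq> 0" using less.prems(1) by auto
    show ?case
    proof (cases "degree g = 0")
      case True
      then obtain c where c: "g = [:c:]" by (rule degree_eq_zeroE)
      then have "c \<noteq> 0" "Const c \<in> J" using \<open>g \<noteq> 0\<close> less.prems(2) by auto
      then have "f * Const (inverse c) * Const c \<in> J" using R(4) f by simp
      then show ?thesis using Const_inverse[OF \<open>c \<noteq> 0\<close>] by (simp add: mult.assoc)
    next
      case False
      then obtain b where "poly g b = 0" using alg_closed_imp_poly_has_root[of g] by auto
      then obtain r where r: "g = [:- b, 1:] * r" by (auto simp: poly_eq_0_iff_dvd)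
      have "r \<noteq> 0" using \<open>g \<noteq> 0\<close> r by auto
      have "degree g = degree [:- b, 1:] + degree r"
        unfolding r using \<open>r \<noteq> 0\<close> by (intro degree_mult_eq) auto
      then have deg: "degree r < degree g" by simp
      have rb: "poly r b \<noteq> 0"
      proof
        assume "poly r b = 0"
        then have "[:- b, 1:] ^ 2 dvd g"
          unfolding r power2_eq_square by (intro mult_dvd_mono) (simp_all add: poly_eq_0_iff_dvd)
        then have "[:- b, 1:] dvd 1" using less.prems(1) squarefreeD by blast
        then show False by (simp add: is_unit_iff_degree)
      qed
      define l where "l = X i - Const b"
      have l: "l \<in> carrier (mpoly_ring n)" using i by (simp add: l_def)
      have lr: "l * subst r (X i) \<in> J" using less.prems(2) by (simp add: r l_def algebra_simps)
      have sr: "subst r (X i) \<in> carrier (mpoly_ring n)" using i by simp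
      have sub: "J \<subseteq> colon n J l" and sub': "J \<subseteq> colon n J (subst r (X i))"
        by (rule ideal_colon(2)[OF less.prems(3)], fact)+
      have "f \<in> colon n J l"
      proof (rule less.hyps[OF deg])
        show "squarefree r" using less.prems(1) r squarefree_mono by (metis dvd_triv_right)
        show "subst r (X i) \<in> colon n J l" using lr sr by (simp add: colon_def)
        show "ideal (colon n J l) (mpoly_ring n)" by (rule ideal_colon(1)[OF less.prems(3) l])
        show "\<exists>a. X j - Const a \<in> colon n J l" if "j \<in> {1..n} - insert i S" for j
          using less.prems(4)[OF that] sub by blast
        show "\<exists>g. squarefree g \<and> subst g (X j) \<in> colon n J l" if "j \<in> insert i S" for j
          using less.prems(5)[OF that] sub by blast
        show "f ^ k \<in> colon n J l" using less.prems(6) sub by blast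
      qed
      then have lf: "l * f \<in> J" by (simp add: colon_def)
      have "f \<in> colon n J (subst r (X i))"
      proof (rule insert.IH)
        fix j assume j: "j \<in> {1..n} - S"
        show "\<exists>a. X j - Const a \<in> colon n J (subst r (X i))"
        proof (cases "j = i")
          case True
          have "l \<in> colon n J (subst r (X i))" using lr l by (simp add: colon_def mult.commute)
          then show ?thesis unfolding l_def True by blast
        next
          case False
          then show ?thesis using sub' less.prems(4)[of j] j by blast
        qed
      next
        show "S \<subseteq> {1..n}" using insert.prems(1) by simp
        show "f \<in> carrier (mpoly_ring n)" by (fact f)
        show "ideal (colon n J (subst r (X i))) (mpoly_ring n)"
          by (rule ideal_colon(1)[OF less.prems(3) sr])
        show "\<exists>g. squarefree g \<and> subst g (X j) \<in> colon n J (subst r (X i))" if "j \<in> S" for j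
          using less.prems(5)[of j] that sub' by blast
        show "f ^ k \<in> colon n J (subst r (X i))" using less.prems(6) sub' by blast
      qed
      then have rf: "subst r (X i) * f \<in> J" by (simp add: colon_def)
      have "poly (r - [:poly r b:]) b = 0" by simp
      then obtain w where w: "r - [:poly r b:] = [:- b, 1:] * w"
        using poly_eq_0_iff_dvd by blast
      have "r = [:- b, 1:] * w + [:poly r b:]"
        by (simp only: w[symmetric] diff_add_cancel)
      then have "subst r (X i) = subst ([:- b, 1:] * w + [:poly r b:]) (X i)" by simp
      then have rw: "subst r (X i) = l * subst w (X i) + Const (poly r b)"
        by (simp add: l_def algebra_simps)
      have "subst r (X i) * f - subst w (X i) * (l * f) \<in> J"
        using R(5)[OF rf R(4)[OF _ lf]] i by simp
      then have "Const (poly r b) * f \<in> J" by (simp add: rw algebra_simps)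
      then have "Const (inverse (poly r b)) * (Const (poly r b) * f) \<in> J" by (rule R(4)[rotated]) simp
      then show ?thesis using Const_inverse[OF rb] by (simp add: mult.assoc[symmetric])
    qed
  qed
qed

section \<open>Separable univariate elements over a perfect field\<close>

abbreviation lift_ac :: "'a::field mpoly \<Rightarrow> 'a alg_closure mpoly" where
  "lift_ac \<equiv> Poly_Mapping.map to_ac"

definition base_linear :: "('a::field alg_closure \<Rightarrow> 'a) \<Rightarrow> bool" where
  "base_linear \<phi> \<longleftrightarrow> (\<forall>x y. \<phi> (x + y) = \<phi> x + \<phi> y) \<and> (\<forall>c x. \<phi> (to_ac c * x) = c * \<phi> x)"

lemma exists_base_linear_retraction:
  obtains \<phi> :: "'a::field alg_closure \<Rightarrow> 'a" where "base_linear \<phi>" "\<phi> 1 = 1"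
proof -
  interpret vs: vector_space_pair "\<lambda>c x. to_ac c * x" "(*) :: 'a \<Rightarrow> 'a \<Rightarrow> 'a"
    by standard (simp_all add: algebra_simps)
  have "vs.vs1.independent {1 :: 'a alg_closure}"
    by (simp add: vs.vs1.dependent_single)
  then obtain \<phi> where "Vector_Spaces.linear (\<lambda>c x. to_ac c * x) (*) \<phi>" "\<phi> 1 = (1 :: 'a)"
    using vs.linear_independent_extend[of "{1}" "\<lambda>_. 1"] by auto
  moreover from this have "base_linear \<phi>"
    using vs.linear_add[of \<phi>] vs.linear_scale[of \<phi>] by (auto simp: base_linear_def)
  ultimately show thesis using that by blast
qed

lemma lookup_map_additive:
  "h 0 = 0 \<Longrightarrow> Poly_Mapping.lookup (Poly_Mapping.map h f) m = h (Poly_Mapping.lookup f m)"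
  by (simp add: map.rep_eq when_def)

lemma map_zero [simp]: "Poly_Mapping.map h 0 = 0"
  by (rule poly_mapping_eqI) (simp add: map.rep_eq)

lemma base_linear_0: "base_linear \<phi> \<Longrightarrow> \<phi> 0 = 0"
  unfolding base_linear_def by (metis to_ac_0 mult_zero_left)

lemma map_additive_add:
  assumes "h 0 = 0" "\<And>x y. h (x + y) = h x + h y"
  shows "Poly_Mapping.map h (f + g) = Poly_Mapping.map h f + Poly_Mapping.map h g"
  by (rule poly_mapping_eqI) (simp add: lookup_map_additive lookup_add assms)

lemma map_closed [simp]:
  "f \<in> carrier (mpoly_ring n) \<Longrightarrow> Poly_Mapping.map h f \<in> carrier (mpoly_ring n)"
  by (auto simp: mpoly_ring_def in_keys_iff map.rep_eq when_def split: if_splits)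

lemma lookup_Const_mult:
  "Poly_Mapping.lookup (Const c * f) m = c * Poly_Mapping.lookup f m"
  unfolding Const_def mult_map_scale_conv_mult[symmetric] by (simp add: lookup_map_additive)

lemma map_X_mult:
  assumes "h 0 = 0" "\<And>x y. h (x + y) = h x + h y"
  shows "Poly_Mapping.map h (X i * f) = X i * Poly_Mapping.map h f"
  by (induction f rule: poly_mapping_induct_single)
    (simp_all add: distrib_left map_additive_add[OF assms] assms(1) X_def mult_single)

lemma lift_ac_add: "lift_ac (f + g) = lift_ac f + lift_ac g"
  by (rule map_additive_add) simp_all

lemma lift_ac_mult: "lift_ac (f * g) = lift_ac f * lift_ac g"
proof (induction f rule: poly_mapping_induct_single)
  case (add m c f)
  have "lift_ac (Poly_Mapping.single m c * g) = lift_ac (Poly_Mapping.single m c) * lift_ac g"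
    by (induction g rule: poly_mapping_induct_single)
      (simp_all add: distrib_left lift_ac_add mult_single)
  then show ?case using add by (simp add: distrib_right lift_ac_add)
qed simp

lemma lift_ac_Const [simp]: "lift_ac (Const c) = Const (to_ac c)"
  by (simp add: Const_def)

lemma lift_ac_X [simp]: "lift_ac (X i) = X i"
  by (simp add: X_def)

lemma lift_ac_power: "lift_ac (f ^ k) = lift_ac f ^ k"
proof (induction k)
  case 0
  show ?case using lift_ac_Const[of 1] by simp
qed (simp add: lift_ac_mult)

lemma lift_ac_subst: "lift_ac (subst p f) = subst (map_poly to_ac p) (lift_ac f)"
  by (induction p) (simp_all add: map_poly_pCons lift_ac_add lift_ac_mult)

text \<open>
  The extension \<open>L \<otimes> J\<close> of \<open>J\<close> to the algebraic closure \<open>L\<close>, described by its coordinates: a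
  polynomial over \<open>L\<close> belongs to it if every linear form \<open>L \<rightarrow> K\<close>, applied to the coefficients,
  sends it into \<open>J\<close>.
\<close>

definition ac_ideal :: "nat \<Rightarrow> 'a::field mpoly set \<Rightarrow> 'a alg_closure mpoly set" where
  "ac_ideal n J =
     {f \<in> carrier (mpoly_ring n). \<forall>\<phi>. base_linear \<phi> \<longrightarrow> Poly_Mapping.map \<phi> f \<in> J}"

text \<open>
  Closure under multiplication by a constant \<open>c\<close> of the closure holds because \<open>\<phi> (c x)\<close> is again a
  linear form in \<open>x\<close>.
\<close>

lemma ideal_ac_ideal:
  fixes J :: "'a::field mpoly set"
  assumes J: "ideal J (mpoly_ring n)"
  shows "ideal (ac_ideal n J) (mpoly_ring n)"
proof -
  note R = mpoly_idealD[OF J]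
  have add: "f + g \<in> ac_ideal n J" if "f \<in> ac_ideal n J" "g \<in> ac_ideal n J" for f g
    using that R(3) by (auto simp: ac_ideal_def map_additive_add base_linear_0 base_linear_def)
  have mult: "h * f \<in> ac_ideal n J" if "h \<in> carrier (mpoly_ring n)" "f \<in> ac_ideal n J" for h f
    using that
  proof (induction h arbitrary: f rule: mpoly_induct)
    case (Const c)
    have "Poly_Mapping.map \<phi> (Const c * f) \<in> J" if "base_linear \<phi>" for \<phi> :: "'a alg_closure \<Rightarrow> 'a"
    proof -
      have comm: "c * (to_ac a * x) = to_ac a * (c * x)" for a x by (rule mult.left_commute)
      have lin: "base_linear (\<lambda>x. \<phi> (c * x))"
        using that by (simp add: base_linear_def distrib_left comm)
      have "Poly_Mapping.map \<phi> (Const c * f) = Poly_Mapping.map (\<lambda>x. \<phi> (c * x)) f"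
        by (rule poly_mapping_eqI) (simp add: lookup_map_additive base_linear_0[OF that] lookup_Const_mult)
      then show ?thesis using lin Const by (simp add: ac_ideal_def)
    qed
    then show ?case using Const by (simp add: ac_ideal_def)
  next
    case (X i)
    have "Poly_Mapping.map \<phi> (X i * f) \<in> J" if "base_linear \<phi>" for \<phi> :: "'a alg_closure \<Rightarrow> 'a"
      using that X R(4)[of "X i"] by (simp add: ac_ideal_def map_X_mult base_linear_0 base_linear_def)
    then show ?case using X by (simp add: ac_ideal_def)
  next
    case (add h h')
    then show ?case using \<open>\<And>g f. f \<in> ac_ideal n J \<Longrightarrow> g \<in> ac_ideal n J \<Longrightarrow> f + g \<in> ac_ideal n J\<close>
      by (simp add: distrib_right)
  next
    case (mult h h')
    then show ?case by (simp add: mult.assoc)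
  qed
  have "0 \<in> ac_ideal n J" using R(1) by (simp add: ac_ideal_def)
  moreover have "ac_ideal n J \<subseteq> carrier (mpoly_ring n)" by (auto simp: ac_ideal_def)
  ultimately show ?thesis using add mult unfolding ideal_mpoly_iff by blast
qed

text \<open>
  On a polynomial with coefficients in \<open>K\<close> a linear form \<open>\<phi>\<close> acts as multiplication by \<open>\<phi> 1\<close>, and
  there is a linear form with \<open>\<phi> 1 = 1\<close>. So extending \<open>J\<close> and restricting again loses nothing.
\<close>

lemma lift_ac_mem_ac_ideal_iff:
  fixes J :: "'a::field mpoly set"
  assumes J: "ideal J (mpoly_ring n)" and f: "f \<in> carrier (mpoly_ring n)"
  shows "lift_ac f \<in> ac_ideal n J \<longleftrightarrow> f \<in> J"
proof -
  have map: "Poly_Mapping.map \<phi> (lift_ac f) = Const (\<phi> 1) * f" if "base_linear \<phi>" for \<phi>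
  proof (rule poly_mapping_eqI)
    fix m
    have "\<phi> (to_ac c * 1) = c * \<phi> 1" for c using that by (simp add: base_linear_def del: mult_1_right)
    then show "Poly_Mapping.lookup (Poly_Mapping.map \<phi> (lift_ac f)) m = Poly_Mapping.lookup (Const (\<phi> 1) * f) m"
      by (simp add: lookup_map_additive base_linear_0[OF that] lookup_Const_mult)
  qed
  show ?thesis
  proof
    assume "lift_ac f \<in> ac_ideal n J"
    moreover obtain \<phi> :: "'a alg_closure \<Rightarrow> 'a" where "base_linear \<phi>" "\<phi> 1 = 1"
      using exists_base_linear_retraction .
    ultimately have "Poly_Mapping.map \<phi> (lift_ac f) \<in> J" by (simp add: ac_ideal_def)
    then show "f \<in> J" using map[OF \<open>base_linear \<phi>\<close>] \<open>\<phi> 1 = 1\<close> by simp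
  next
    assume "f \<in> J"
    then show "lift_ac f \<in> ac_ideal n J"
      using map mpoly_idealD(4)[OF J] f by (simp add: ac_ideal_def)
  qed
qed

lemma map_poly_to_ac_hom:
  "map_poly to_ac (p + q) = map_poly to_ac p + map_poly to_ac q"
  "map_poly to_ac (p * q) = map_poly to_ac p * map_poly to_ac q"
  "map_poly to_ac (pderiv p) = pderiv (map_poly to_ac p)"
proof -
  show add: "map_poly to_ac (p + q) = map_poly to_ac p + map_poly to_ac q" for p q :: "'a poly"
    by (rule poly_eqI) (simp add: coeff_map_poly)
  have smult: "map_poly to_ac (smult c p) = smult (to_ac c) (map_poly to_ac p)" for c and p :: "'a poly"
    by (rule poly_eqI) (simp add: coeff_map_poly)
  show "map_poly to_ac (p * q) = map_poly to_ac p * map_poly to_ac q"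
    by (induction p) (simp_all add: map_poly_pCons add smult)
  show "map_poly to_ac (pderiv p) = pderiv (map_poly to_ac p)"
    by (rule poly_eqI) (simp add: coeff_map_poly coeff_pderiv)
qed

lemma squarefree_map_poly_to_ac:
  fixes g :: "'a::field poly"
  assumes "perfect_field TYPE('a)" "squarefree g"
  shows "squarefree (map_poly to_ac g)" (is "squarefree ?g")
proof (rule squarefreeI)
  obtain u v where "u * g + v * pderiv g = 1" using squarefree_comaximal_pderiv[OF assms] .
  then have "map_poly to_ac (u * g + v * pderiv g) = 1" by simp
  then have bezout: "map_poly to_ac u * ?g + map_poly to_ac v * pderiv ?g = 1"
    by (simp add: map_poly_to_ac_hom)
  fix q assume "q\<^sup>2 dvd ?g"
  then obtain r where "?g = q\<^sup>2 * r" by (rule dvdE)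
  then have r: "?g = q * (q * r)" by (simp add: power2_eq_square mult.assoc)
  then have "q dvd ?g" "q dvd pderiv ?g" by (simp_all add: pderiv_mult)
  then have "q dvd map_poly to_ac u * ?g + map_poly to_ac v * pderiv ?g" by (intro dvd_add dvd_mult)
  then show "q dvd 1" unfolding bezout .
qed

text \<open>
  Seidenberg's criterion. It is transported from the algebraic closure, where the polynomials \<open>g\<close>
  remain squarefree because the base field is perfect.
\<close>

lemma radical_if_squarefree_univariate:
  fixes J :: "'a::field mpoly set"
  assumes perf: "perfect_field TYPE('a)" and J: "ideal J (mpoly_ring n)"
    and g: "\<And>i. i \<in> {1..n} \<Longrightarrow> \<exists>g. squarefree g \<and> subst g (X i) \<in> J"
    and f: "f \<in> carrier (mpoly_ring n)" "f ^ k \<in> J"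
  shows "f \<in> J"
proof -
  have "lift_ac f \<in> ac_ideal n J"
  proof (rule radical_if_squarefree_univariate_alg_closed[of "{1..n}"])
    show "ideal (ac_ideal n J) (mpoly_ring n)" by (rule ideal_ac_ideal[OF J])
    show "lift_ac f ^ k \<in> ac_ideal n J"
      using lift_ac_mem_ac_ideal_iff[OF J, of "f ^ k"] f by (simp add: lift_ac_power)
    fix i assume i: "i \<in> {1..n}"
    then obtain p where p: "squarefree p" "subst p (X i) \<in> J" using g by blast
    then have "subst (map_poly to_ac p) (X i) \<in> ac_ideal n J"
      using lift_ac_mem_ac_ideal_iff[OF J, of "subst p (X i)"] i by (simp add: lift_ac_subst)
    then show "\<exists>g. squarefree g \<and> subst g (X i) \<in> ac_ideal n J"
      using squarefree_map_poly_to_ac[OF perf p(1)] by blast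
  qed (use f in auto)
  then show ?thesis using lift_ac_mem_ac_ideal_iff[OF J f(1)] by blast
qed

section \<open>Dimension of the quotient\<close>

lemma subfield_Const: "subfield (range Const) (mpoly_ring n :: 'a::field mpoly ring)"
proof (rule ring.subfieldI[OF ring_mpoly])
  have "subring (range Const) (mpoly_ring n :: 'a mpoly ring)"
  proof (rule ring.subringI[OF ring_mpoly])
    show "\<one>\<^bsub>mpoly_ring n\<^esub> \<in> range (Const :: 'a \<Rightarrow> _)" by (auto intro: range_eqI[of _ _ 1])
    fix h h' :: "'a mpoly" assume "h \<in> range Const" "h' \<in> range Const"
    then obtain a b where ab: "h = Const a" "h' = Const b" by blast
    have "Const (a * b) \<in> range Const" "Const (a + b) \<in> range Const" "Const (- a) \<in> range Const"
      by blast+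
    then show "h \<otimes>\<^bsub>mpoly_ring n\<^esub> h' \<in> range Const" "h \<oplus>\<^bsub>mpoly_ring n\<^esub> h' \<in> range Const"
      "\<ominus>\<^bsub>mpoly_ring n\<^esub> h \<in> range Const"
      by (simp_all add: ab)
  qed auto
  then show "subcring (range Const) (mpoly_ring n :: 'a mpoly ring)"
    by (rule ring.subcringI[OF ring_mpoly]) (simp add: mult.commute)
  let ?R = "mpoly_ring n \<lparr>carrier := range (Const :: 'a \<Rightarrow> _)\<rparr>"
  show "Units ?R = range Const - {\<zero>\<^bsub>mpoly_ring n\<^esub>}"
  proof (intro equalityI subsetI)
    fix y assume "y \<in> Units ?R"
    then show "y \<in> range Const - {\<zero>\<^bsub>mpoly_ring n\<^esub>}" by (auto simp: Units_def)
  next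
    fix y assume "y \<in> range (Const :: 'a \<Rightarrow> _) - {\<zero>\<^bsub>mpoly_ring n\<^esub>}"
    then obtain c where c: "y = Const c" "Const c \<noteq> 0" by auto
    then have "c \<noteq> 0" by auto
    then show "y \<in> Units ?R"
      using Const_inverse[OF \<open>c \<noteq> 0\<close>] c by (auto simp: Units_def mult.commute intro!: bexI[of _ "Const (inverse c)"])
  qed
qed

lemma quot_coset_eq_iff:
  assumes J: "ideal J (mpoly_ring n)"
    and f: "f \<in> carrier (mpoly_ring n)" and g: "g \<in> carrier (mpoly_ring n)"
  shows "J +>\<^bsub>mpoly_ring n\<^esub> f = J +>\<^bsub>mpoly_ring n\<^esub> g \<longleftrightarrow> f - g \<in> J"
  using ring.quotient_eq_iff_same_a_r_cos[OF ring_mpoly J f g] g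
  by (simp add: a_minus_def)

lemma quot_coset_eq_zero_iff:
  assumes J: "ideal J (mpoly_ring n)" and f: "f \<in> carrier (mpoly_ring n)"
  shows "J +>\<^bsub>mpoly_ring n\<^esub> f = \<zero>\<^bsub>mpoly_ring n Quot J\<^esub> \<longleftrightarrow> f \<in> J"
proof -
  have "J \<subseteq> carrier (mpoly_ring n)" using mpoly_idealD(2)[OF J] by blast
  then have "\<zero>\<^bsub>mpoly_ring n Quot J\<^esub> = J +>\<^bsub>mpoly_ring n\<^esub> 0"
    using abelian_group.a_coset_add_zero[OF ring.is_abelian_group[OF ring_mpoly], of J n]
    by (simp add: FactRing_def)
  then show ?thesis using quot_coset_eq_iff[OF J f, of 0] by simp
qed

lemma carrier_quot: "carrier (mpoly_ring n Quot J) = (+>\<^bsub>mpoly_ring n\<^esub>) J ` carrier (mpoly_ring n)"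
  by (auto simp: FactRing_def A_RCOSETS_def')

lemma eval_kernel_eq:
  assumes "ideal J (mpoly_ring n)" "f \<in> carrier (mpoly_ring n)"
  shows "eval_kernel n f J = {g. subst g f \<in> J}"
  using quot_coset_eq_zero_iff[OF assms(1)] assms(2) by (simp add: eval_kernel_def)

lemma combine_powers:
  "ring.combine (mpoly_ring n) (map Const cs) (map (\<lambda>j. x ^ j) [k..<k + length cs]) = x ^ k * subst (Poly cs) x"
proof (induction cs arbitrary: k)
  case Nil
  then show ?case by (simp add: ring.combine.simps[OF ring_mpoly])
next
  case (Cons c cs)
  have "[k..<k + length (c # cs)] = k # [Suc k..<Suc k + length cs]"
    by (simp add: upt_conv_Cons del: upt_Suc)
  then show ?case using Cons[of "Suc k"]
    by (simp add: ring.combine.simps[OF ring_mpoly] algebra_simps)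
qed

text \<open>
  Properness of \<open>J\<close> is what makes the image of \<open>K\<close> in \<open>P/J\<close> a field, so that dimension theory over
  it applies.
\<close>

locale proper_ideal =
  fixes n :: nat and J :: "'a::field mpoly set"
  assumes J: "ideal J (mpoly_ring n)" and proper: "1 \<notin> J"
begin

abbreviation "R \<equiv> mpoly_ring n :: 'a mpoly ring"
abbreviation "Q \<equiv> mpoly_ring n Quot J"
abbreviation "h \<equiv> (+>\<^bsub>mpoly_ring n\<^esub>) J"

sublocale hom: ring_hom_ring R Q h
  by (rule ideal.rcos_ring_hom_ring[OF J])

lemma scalars_eq: "quot_scalars n J = h ` range Const"
  by (simp add: quot_scalars_def image_image)

lemma subfield_scalars: "subfield (quot_scalars n J) Q"
proof -
  have "\<one>\<^bsub>Q\<^esub> \<noteq> \<zero>\<^bsub>Q\<^esub>"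
    using quot_coset_eq_zero_iff[OF J, of 1] proper hom.hom_one by simp
  then show ?thesis unfolding scalars_eq by (rule hom.img_is_subfield(2)[OF subfield_Const])
qed

lemma scalars_list:
  assumes "set Ks \<subseteq> quot_scalars n J"
  obtains cs where "Ks = map h (map Const cs)"
proof -
  have "\<forall>y\<in>set Ks. \<exists>c. y = h (Const c)" using assms by (auto simp: quot_scalars_def)
  then obtain cs where "Ks = map (\<lambda>c. h (Const c)) cs" using ex_map_conv by metis
  then show thesis using that by (simp add: comp_def)
qed

lemma carrier_list:
  assumes "set Us \<subseteq> carrier Q"
  obtains fs where "set fs \<subseteq> carrier R" "Us = map h fs"
proof -
  have "Us \<in> lists (h ` carrier R)" using assms by (simp add: carrier_quot in_lists_conv_set subset_iff)
  then have "Us \<in> map h ` lists (carrier R)" by (simp add: lists_image)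
  then show thesis using that by auto
qed

lemma combine_quot_powers:
  assumes "x \<in> carrier R"
  shows "hom.S.combine (map h (map Const cs)) (map h (map (\<lambda>j. x ^ j) [0..<length cs]))
    = h (subst (Poly cs) x)"
proof -
  have "hom.S.combine (map h (map Const cs)) (map h (map (\<lambda>j. x ^ j) [0..<length cs]))
      = h (hom.R.combine (map Const cs) (map (\<lambda>j. x ^ j) [0..<length cs]))"
    by (rule hom.combine_hom) (use assms in auto)
  also have "\<dots> = h (subst (Poly cs) x)"
    using combine_powers[of n cs x 0] by simp
  finally show ?thesis .
qed

lemma dependent_powers:
  assumes x: "x \<in> carrier R"
    and dep: "\<not> hom.S.independent (quot_scalars n J) (map h (map (\<lambda>j. x ^ j) [0..<m]))"
  obtains p where "p \<noteq> 0" "degree p < m" "subst p x \<in> J"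
proof -
  have "set (map (\<lambda>j. x ^ j) [0..<m]) \<subseteq> carrier R" using x by auto
  then have "set (map h (map (\<lambda>j. x ^ j) [0..<m])) \<subseteq> carrier Q" by (auto simp: carrier_quot)
  then obtain Ks where Ks: "length Ks = m" "set Ks \<subseteq> quot_scalars n J" "set Ks \<noteq> {\<zero>\<^bsub>Q\<^esub>}"
      "hom.S.combine Ks (map h (map (\<lambda>j. x ^ j) [0..<m])) = \<zero>\<^bsub>Q\<^esub>"
    using hom.S.dependent_imp_non_trivial_combine[OF subfield_scalars _ dep] by (metis length_map length_upt minus_nat.diff_0)
  obtain cs where cs: "Ks = map h (map Const cs)" using scalars_list[OF Ks(2)] .
  have len: "length cs = m" using Ks(1) cs by simp
  have "h (subst (Poly cs) x) = \<zero>\<^bsub>Q\<^esub>"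
    using Ks(4) combine_quot_powers[OF x, of cs] by (simp only: cs len)
  then have mem: "subst (Poly cs) x \<in> J" using quot_coset_eq_zero_iff[OF J] x by simp
  have "m \<noteq> 0" using dep hom.S.independent.li_Nil by (metis list.simps(8) upt_0)
  have nz: "Poly cs \<noteq> 0"
  proof
    assume "Poly cs = 0"
    then obtain l where "cs = replicate l 0" by (auto simp: Poly_eq_0)
    then have "Ks = replicate m (h 0)" using len by (simp add: cs)
    then have "set Ks = {\<zero>\<^bsub>Q\<^esub>}" using \<open>m \<noteq> 0\<close> hom.hom_zero by simp
    then show False using Ks(3) by blast
  qed
  then have "nth_default 0 cs (degree (Poly cs)) \<noteq> 0" by (metis coeff_Poly_eq leading_coeff_0_iff)
  then have "degree (Poly cs) < m" using len nth_default_beyond by (metis not_less)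
  then show thesis using that nz mem by blast
qed

text \<open>Otherwise \<open>d + 1\<close> powers of \<open>x\<close> would be independent in a space of dimension \<open>d\<close>.\<close>

lemma exists_minpoly:
  assumes d: "quot_dim n J d" and x: "x \<in> carrier R"
  obtains \<mu> where "is_minpoly n x J \<mu>"
proof -
  have "set (map h (map (\<lambda>j. x ^ j) [0..<Suc d])) \<subseteq> carrier Q" using x by (auto simp: carrier_quot)
  then have "\<not> hom.S.independent (quot_scalars n J) (map h (map (\<lambda>j. x ^ j) [0..<Suc d]))"
    using hom.S.independent_length_le_dimension[OF subfield_scalars d[unfolded quot_dim_def]] by fastforce
  then obtain p where p: "p \<noteq> 0" "subst p x \<in> J" using dependent_powers[OF x] by metis
  note R = mpoly_idealD[OF J]
  obtain \<mu> where "lead_coeff \<mu> = 1" "{g. subst g x \<in> J} = range (\<lambda>q. \<mu> * q)"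
    by (rule poly_ideal_principal[of "{g. subst g x \<in> J}"])
      (use R(1,3,4) p x in auto)
  then show thesis using that by (simp add: is_minpoly_def eval_kernel_eq[OF J x])
qed

text \<open>
  A relation between \<open>1, x, \<dots>, x\<^sup>d\<^sup>-\<^sup>1\<close> modulo \<open>J\<close> would be a multiple of \<open>\<mu>\<close> of degree less than \<open>d\<close>.
  So these \<open>d\<close> powers are independent, and they form a basis of \<open>P/J\<close>.
\<close>

lemma powers_span_if_degree_eq_dim:
  assumes d: "quot_dim n J d" and x: "x \<in> carrier R"
    and ker: "\<And>g. subst g x \<in> J \<Longrightarrow> \<mu> dvd g" and deg: "degree \<mu> = d"
    and f: "f \<in> carrier R"
  obtains g where "f - subst g x \<in> J"
proof -
  let ?Us = "map h (map (\<lambda>j. x ^ j) [0..<d])"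
  have Us: "set ?Us \<subseteq> carrier Q" using x by (auto simp: carrier_quot)
  have "hom.S.independent (quot_scalars n J) ?Us"
  proof (rule ccontr)
    assume "\<not> hom.S.independent (quot_scalars n J) ?Us"
    then obtain p where p: "p \<noteq> 0" "degree p < d" "subst p x \<in> J" using dependent_powers[OF x] by blast
    then show False using dvd_imp_degree_le[OF ker[OF p(3)]] deg by simp
  qed
  then have "hom.S.Span (quot_scalars n J) ?Us = carrier Q"
    using hom.S.independent_length_eq_dimension[OF subfield_scalars d[unfolded quot_dim_def] _ Us] by simp
  then have "h f \<in> hom.S.Span (quot_scalars n J) ?Us" using f by (simp add: carrier_quot)
  then obtain Ks where Ks: "set Ks \<subseteq> quot_scalars n J" "length Ks = d" "h f = hom.S.combine Ks ?Us"
    using hom.S.Span_mem_iff_length_version[OF subfield_scalars Us] by auto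
  obtain cs where cs: "Ks = map h (map Const cs)" using scalars_list[OF Ks(1)] .
  have "length cs = d" using Ks(2) cs by simp
  then have "h f = h (subst (Poly cs) x)"
    using Ks(3) combine_quot_powers[OF x, of cs] by (simp only: cs)
  then have "f - subst (Poly cs) x \<in> J" using quot_coset_eq_iff[OF J f] x by simp
  then show thesis using that by blast
qed

end

text \<open>
  The images in \<open>P/J'\<close> of a basis of \<open>P/J\<close> span.
\<close>

lemma quot_dim_superideal:
  fixes J J' :: "'a::field mpoly set"
  assumes d: "quot_dim n J d" and J: "ideal J (mpoly_ring n)" and J': "ideal J' (mpoly_ring n)"
    and sub: "J \<subseteq> J'" and proper: "1 \<notin> J'"
  obtains d' where "quot_dim n J' d'"
proof -
  interpret A: proper_ideal n J by (rule proper_ideal.intro) (use J sub proper in blast)+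
  interpret B: proper_ideal n J' by (rule proper_ideal.intro) fact+
  obtain Vs where Vs: "set Vs \<subseteq> carrier A.Q" "A.hom.S.Span (quot_scalars n J) Vs = carrier A.Q"
    using A.hom.S.exists_base[OF A.subfield_scalars d[unfolded quot_dim_def]] by blast
  obtain fs where fs: "set fs \<subseteq> carrier A.R" "Vs = map A.h fs" using A.carrier_list[OF Vs(1)] .
  have K: "range (Const :: 'a \<Rightarrow> _) \<subseteq> carrier A.R" by auto
  have S: "A.hom.R.Span (range Const) fs \<subseteq> carrier A.R"
    by (rule A.hom.R.Span_in_carrier[OF K fs(1)])
  have A: "A.h ` A.hom.R.Span (range Const) fs = A.h ` carrier A.R"
    using Vs(2) A.hom.Span_hom[OF K fs(1)] by (simp only: fs(2) A.scalars_eq carrier_quot)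
  have "B.h ` A.hom.R.Span (range Const) fs = B.h ` carrier A.R"
  proof (intro equalityI subsetI)
    fix y assume "y \<in> B.h ` carrier A.R"
    then obtain f where f: "f \<in> carrier A.R" "y = B.h f" by blast
    then obtain s where s: "s \<in> A.hom.R.Span (range Const) fs" "A.h f = A.h s" using A by blast
    then have "f - s \<in> J'" using quot_coset_eq_iff[OF J f(1)] S sub by blast
    then have "B.h f = B.h s" using quot_coset_eq_iff[OF J' f(1)] s(1) S by blast
    then show "y \<in> B.h ` A.hom.R.Span (range Const) fs" using s(1) f(2) by blast
  qed (use S in blast)
  then have "B.hom.S.Span (quot_scalars n J') (map B.h fs) = carrier B.Q"
    using B.hom.Span_hom[OF K fs(1)] by (simp only: B.scalars_eq carrier_quot)
  moreover have "set (map B.h fs) \<subseteq> carrier B.Q" using fs(1) by (auto simp: carrier_quot)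
  ultimately have "B.hom.S.finite_dimension (quot_scalars n J') (carrier B.Q)"
    using B.hom.S.Span_finite_dimension[OF B.subfield_scalars] by metis
  then show thesis using that by (auto simp: B.hom.S.finite_dimension_def quot_dim_def)
qed

section \<open>The procedure\<close>

lemma radical_mpoly_iff:
  "f \<in> radical (mpoly_ring n) I \<longleftrightarrow> f \<in> carrier (mpoly_ring n) \<and> (\<exists>k>0. f ^ k \<in> I)"
  by (auto simp: radical_def)

definition adjoin :: "nat \<Rightarrow> 'a::field mpoly set \<Rightarrow> 'a mpoly \<Rightarrow> 'a mpoly set" where
  "adjoin n J w = J <+>\<^bsub>mpoly_ring n\<^esub> Idl\<^bsub>mpoly_ring n\<^esub> {w}"

lemma adjoin_properties:
  assumes J: "ideal J (mpoly_ring n)" and w: "w \<in> carrier (mpoly_ring n)"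
  shows "ideal (adjoin n J w) (mpoly_ring n)" "J \<subseteq> adjoin n J w" "w \<in> adjoin n J w"
    "f \<in> adjoin n J w \<Longrightarrow> \<exists>h\<in>carrier (mpoly_ring n). f - h * w \<in> J"
proof -
  note R = mpoly_idealD[OF J]
  have Idl: "Idl\<^bsub>mpoly_ring n\<^esub> {w} = {h * w |h. h \<in> carrier (mpoly_ring n)}"
    using cring.cgenideal_eq_genideal[OF cring_mpoly_ring w] by (simp add: cgenideal_def)
  show "ideal (adjoin n J w) (mpoly_ring n)" unfolding adjoin_def
    using ring.add_ideals[OF ring_mpoly J ring.genideal_ideal[OF ring_mpoly]] w by simp
  have eq: "adjoin n J w = {j + h * w |j h. j \<in> J \<and> h \<in> carrier (mpoly_ring n)}"
    unfolding adjoin_def Idl set_add_def' by auto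
  have "j + 0 * w \<in> adjoin n J w" if "j \<in> J" for j
    unfolding eq using that mpoly_zero_one_closed(1) by blast
  then show "J \<subseteq> adjoin n J w" by auto
  have "0 + 1 * w \<in> adjoin n J w"
    unfolding eq using R(1) mpoly_zero_one_closed(2) by blast
  then show "w \<in> adjoin n J w" by simp
  show "\<exists>h\<in>carrier (mpoly_ring n). f - h * w \<in> J" if f: "f \<in> adjoin n J w"
  proof -
    obtain j h where "f = j + h * w" "j \<in> J" "h \<in> carrier (mpoly_ring n)" using f unfolding eq by blast
    then show ?thesis by (auto intro!: bexI[of _ h])
  qed
qed

text \<open>
  Since \<open>\<mu>\<close> divides a power of \<open>\<nu>\<close>, the element \<open>\<nu>(x)\<close> is nilpotent modulo \<open>J\<close>, and hence so is
  every element of the enlarged ideal. If \<open>g(x)\<close> lies in that ideal, then some \<open>g\<^sup>k(x)\<close> lies in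
  \<open>J\<close>, so \<open>\<nu>\<close> divides \<open>\<mu>\<close>, which divides \<open>g\<^sup>k\<close>; as \<open>\<nu>\<close> is squarefree it divides \<open>g\<close>. The new
  minimal polynomial of \<open>x\<close> is therefore \<open>\<nu>\<close>, up to a constant.
\<close>

lemma adjoin_sqfree_part:
  fixes J :: "'a::field mpoly set"
  assumes J: "ideal J (mpoly_ring n)" and x: "x \<in> carrier (mpoly_ring n)"
    and ker: "\<And>g. subst g x \<in> J \<longleftrightarrow> \<mu> dvd g" and "\<mu> \<noteq> 0" and \<nu>: "is_sqfree \<mu> \<nu>"
  shows "f \<in> adjoin n J (subst \<nu> x) \<Longrightarrow> \<exists>k>0. f ^ k \<in> J"
    "subst g x \<in> adjoin n J (subst \<nu> x) \<longleftrightarrow> \<nu> dvd g"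
proof -
  note R = mpoly_idealD[OF J]
  note sq = is_sqfree_properties[OF \<open>\<mu> \<noteq> 0\<close> \<nu>]
  have w: "subst \<nu> x \<in> carrier (mpoly_ring n)" using x by simp
  note adj = adjoin_properties[OF J w]
  show pow: "\<exists>k>0. f ^ k \<in> J" if f: "f \<in> adjoin n J (subst \<nu> x)" for f
  proof -
    obtain h where h: "h \<in> carrier (mpoly_ring n)" "f - h * subst \<nu> x \<in> J" using adj(4)[OF f] by blast
    obtain k where "\<mu> dvd \<nu> ^ k" using sq(3) by blast
    \<comment> \<open>The exponent is raised by one because \<open>k = 0\<close> is possible when \<open>\<mu>\<close> is constant.\<close>
    then have "\<mu> dvd \<nu> ^ Suc k" by simp
    then have "subst (\<nu> ^ Suc k) x \<in> J" using ker by blast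
    then have "h ^ Suc k * subst (\<nu> ^ Suc k) x \<in> J" using h(1) by (intro R(4)) simp_all
    then have wk: "(h * subst \<nu> x) ^ Suc k \<in> J" by (simp only: power_mult_distrib subst_power)
    have "f \<in> carrier (mpoly_ring n)" using mpoly_idealD(2)[OF adj(1) f] .
    then have "f ^ Suc k - (h * subst \<nu> x) ^ Suc k \<in> J"
      using power_diff_in_ideal[OF J _ _ h(2)] h(1) w by blast
    from R(3)[OF this wk] have "f ^ Suc k \<in> J" by simp
    then show ?thesis by blast
  qed
  show "subst g x \<in> adjoin n J (subst \<nu> x) \<longleftrightarrow> \<nu> dvd g"
  proof
    assume "subst g x \<in> adjoin n J (subst \<nu> x)"
    then obtain k where "subst (g ^ k) x \<in> J" using pow by auto
    then have "\<nu> dvd g ^ k" using ker sq(2) dvd_trans by blast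
    then show "\<nu> dvd g" using squarefree_dvd_power_imp_dvd[OF sq(1)] by blast
  next
    assume "\<nu> dvd g"
    then obtain q where "g = q * \<nu>" by (metis dvd_def mult.commute)
    then show "subst g x \<in> adjoin n J (subst \<nu> x)"
      using mpoly_idealD(4)[OF adj(1) _ adj(3)] x by simp
  qed
qed

text \<open>
  Here \<open>P/J\<close> is isomorphic to \<open>K[z]/(\<mu>)\<close>, which has no nilpotent elements.
\<close>

lemma radical_if_generated_by_squarefree:
  assumes "proper_ideal n J" and d: "quot_dim n J d" and x: "x \<in> carrier (mpoly_ring n)"
    and ker: "\<And>g. subst g x \<in> J \<longleftrightarrow> \<mu> dvd g" and "squarefree \<mu>" "degree \<mu> = d"
    and f: "f \<in> carrier (mpoly_ring n)" "f ^ k \<in> J"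
  shows "f \<in> J"
proof -
  interpret proper_ideal n J by fact
  note R = mpoly_idealD[OF J]
  obtain g where g: "f - subst g x \<in> J"
    using powers_span_if_degree_eq_dim[OF d x _ \<open>degree \<mu> = d\<close> f(1)] ker by blast
  have "f ^ k - subst g x ^ k \<in> J"
    using power_diff_in_ideal[OF J f(1) _ g] x by simp
  from R(5)[OF f(2) this] have "subst (g ^ k) x \<in> J" by simp
  then have "\<mu> dvd g" using ker squarefree_dvd_power_imp_dvd[OF \<open>squarefree \<mu>\<close>] by blast
  then have "subst g x \<in> J" using ker by blast
  from R(3)[OF g this] show ?thesis by simp
qed

definition between :: "nat \<Rightarrow> 'a::field mpoly set \<Rightarrow> 'a mpoly set \<Rightarrow> nat \<Rightarrow> bool" where
  "between n I J d \<longleftrightarrow>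
     ideal J (mpoly_ring n) \<and> I \<subseteq> J \<and> J \<subseteq> radical (mpoly_ring n) I \<and> quot_dim n J d"

definition squarefree_upto :: "nat \<Rightarrow> 'a::field mpoly set \<Rightarrow> bool" where
  "squarefree_upto i J \<longleftrightarrow> (\<forall>j\<in>{1..<i}. \<exists>g. squarefree g \<and> subst g (X j) \<in> J)"

text \<open>
  The polynomial \<open>\<mu>\<close> is described by divisibility, not as the minimal polynomial, because the
  square-free part that replaces it need not be monic.
\<close>

fun invariant :: "nat \<Rightarrow> 'a::field mpoly set \<Rightarrow> ('a mpoly, 'a poly) config \<Rightarrow> bool" where
  "invariant n I (Start J) \<longleftrightarrow> J = I"
| "invariant n I (Loop i J d) \<longleftrightarrow> i \<ge> 1 \<and> between n I J d \<and> squarefree_upto i J"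
| "invariant n I (Test_Sqfree i J d \<mu>) \<longleftrightarrow>
     i \<in> {1..n} \<and> between n I J d \<and> squarefree_upto i J \<and> \<mu> \<noteq> 0 \<and> (\<forall>g. subst g (X i) \<in> J \<longleftrightarrow> \<mu> dvd g)"
| "invariant n I (Test_Degree i J d \<mu>) \<longleftrightarrow>
     i \<in> {1..n} \<and> between n I J d \<and> squarefree_upto (Suc i) J \<and> squarefree \<mu> \<and>
     (\<forall>g. subst g (X i) \<in> J \<longleftrightarrow> \<mu> dvd g)"
| "invariant n I (Return J) \<longleftrightarrow> J = radical (mpoly_ring n) I"

lemma between_eq_radical:
  assumes "between n I J d"
    and "\<And>f k. f \<in> carrier (mpoly_ring n) \<Longrightarrow> f ^ k \<in> J \<Longrightarrow> f \<in> J"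
  shows "J = radical (mpoly_ring n) I"
  using assms by (force simp: between_def radical_mpoly_iff)

lemma between_proper:
  assumes "between n I J d" "1 \<notin> I"
  shows "proper_ideal n J"
  using assms by (auto simp: between_def proper_ideal_def radical_mpoly_iff)

lemma between_adjoin:
  assumes J: "between n I J d" and w: "w \<in> carrier (mpoly_ring n)"
    and pow: "\<And>f. f \<in> adjoin n J w \<Longrightarrow> \<exists>k>0. f ^ k \<in> J"
  shows "adjoin n J w \<subseteq> radical (mpoly_ring n) I"
proof
  fix f assume f: "f \<in> adjoin n J w"
  have ideal: "ideal J (mpoly_ring n)" and sub: "J \<subseteq> radical (mpoly_ring n) I"
    using J by (auto simp: between_def)
  obtain k where k: "k > 0" "f ^ k \<in> J" using pow[OF f] by blast
  then have "f ^ k \<in> radical (mpoly_ring n) I" using sub by blast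
  then obtain l where l: "l > 0" "(f ^ k) ^ l \<in> I" unfolding radical_mpoly_iff by blast
  then have "k * l > 0" "f ^ (k * l) \<in> I" using k(1) by (simp_all add: power_mult)
  then show "f \<in> radical (mpoly_ring n) I"
    using mpoly_idealD(2)[OF adjoin_properties(1)[OF ideal w] f] unfolding radical_mpoly_iff by blast
qed

lemma squarefree_upto_mono: "squarefree_upto i J \<Longrightarrow> J \<subseteq> J' \<Longrightarrow> squarefree_upto i J'"
  unfolding squarefree_upto_def by blast

lemma squarefree_upto_Suc:
  "squarefree_upto i J \<Longrightarrow> squarefree g \<Longrightarrow> subst g (X i) \<in> J \<Longrightarrow> squarefree_upto (Suc i) J"
  unfolding squarefree_upto_def by (metis atLeastLessThan_iff less_Suc_eq)

lemma minpoly_iff: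
  assumes "ideal J (mpoly_ring n)" "x \<in> carrier (mpoly_ring n)" "is_minpoly n x J \<mu>"
  shows "\<mu> \<noteq> 0" "subst g x \<in> J \<longleftrightarrow> \<mu> dvd g"
proof -
  show "\<mu> \<noteq> 0" using assms(3) by (auto simp: is_minpoly_def)
  have "{g. subst g x \<in> J} = range (\<lambda>q. \<mu> * q)"
    using assms(3) by (simp add: is_minpoly_def eval_kernel_eq[OF assms(1,2)])
  then show "subst g x \<in> J \<longleftrightarrow> \<mu> dvd g" by (auto simp: dvd_def set_eq_iff)
qed

lemma invariant_step:
  fixes I :: "'a::field mpoly set"
  assumes perf: "perfect_field TYPE('a)" and I: "ideal I (mpoly_ring n)" "1 \<notin> I"
    and inv: "invariant n I c" and step: "step n c c'"
  shows "invariant n I c'"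
  using step inv
proof cases
  case (init I' d)
  moreover have "I \<subseteq> radical (mpoly_ring n) I"
    using mpoly_idealD(2)[OF I(1)] by (auto simp: radical_mpoly_iff intro!: exI[of _ "1::nat"])
  ultimately show ?thesis using inv I(1) by (auto simp: between_def squarefree_upto_def)
next
  case (loop_end i J d)
  then have J: "between n I J d" and sq: "squarefree_upto i J" using inv by auto
  then have "J = radical (mpoly_ring n) I"
  proof (intro between_eq_radical[OF J])
    fix f k assume f: "f \<in> carrier (mpoly_ring n)" "f ^ k \<in> J"
    show "f \<in> J"
    proof (rule radical_if_squarefree_univariate[OF perf _ _ f])
      show "ideal J (mpoly_ring n)" using J by (simp add: between_def)
      show "\<exists>g. squarefree g \<and> subst g (X j) \<in> J" if "j \<in> {1..n}" for j
        using sq that loop_end by (simp add: squarefree_upto_def)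
    qed
  qed
  then show ?thesis using loop_end by simp
next
  case (loop_minpoly i J \<mu> d)
  then show ?thesis using inv minpoly_iff[of J n "X i" \<mu>] by (auto simp: between_def)
next
  case (already_sqfree \<mu> i J d)
  then show ?thesis using inv squarefree_upto_Suc[of i J \<mu>] by auto
next
  case (make_sqfree \<mu> \<nu> J' J i d' d)
  then have i: "i \<in> {1..n}" and J: "between n I J d" and sq: "squarefree_upto i J" and "\<mu> \<noteq> 0"
    and ker: "\<And>g. subst g (X i) \<in> J \<longleftrightarrow> \<mu> dvd g"
    using inv by auto
  have J': "J' = adjoin n J (subst \<nu> (X i))" using make_sqfree by (simp add: adjoin_def)
  have ideal: "ideal J (mpoly_ring n)" using J by (simp add: between_def)
  have x: "X i \<in> carrier (mpoly_ring n :: 'a mpoly ring)" and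
    w: "subst \<nu> (X i) \<in> carrier (mpoly_ring n)" using i by simp_all
  note adj = adjoin_properties[OF ideal w]
  note part = adjoin_sqfree_part[OF ideal x ker \<open>\<mu> \<noteq> 0\<close> \<open>is_sqfree \<mu> \<nu>\<close>]
  have "squarefree \<nu>" using is_sqfree_properties(1)[OF \<open>\<mu> \<noteq> 0\<close> \<open>is_sqfree \<mu> \<nu>\<close>] .
  moreover have "between n I J' d'"
    using J adj(1,2) between_adjoin[OF J w part(1)] make_sqfree by (auto simp: between_def J')
  moreover have "squarefree_upto (Suc i) J'"
    using squarefree_upto_Suc[OF squarefree_upto_mono[OF sq adj(2)] \<open>squarefree \<nu>\<close> adj(3)] by (simp add: J')
  ultimately show ?thesis using make_sqfree(2) i part(2) by (simp add: J')
next
  case (early_return \<mu> d i J)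
  then have i: "i \<in> {1..n}" and J: "between n I J d" and "squarefree \<mu>"
    and ker: "\<And>g. subst g (X i) \<in> J \<longleftrightarrow> \<mu> dvd g"
    using inv by auto
  have "J = radical (mpoly_ring n) I"
  proof (intro between_eq_radical[OF J])
    fix f k assume f: "f \<in> carrier (mpoly_ring n)" "f ^ k \<in> J"
    show "f \<in> J"
      by (rule radical_if_generated_by_squarefree[OF between_proper[OF J I(2)] _ _ ker \<open>squarefree \<mu>\<close> _ f])
        (use J i early_return in \<open>auto simp: between_def\<close>)
  qed
  then show ?thesis using early_return by simp
next
  case (loop_next \<mu> d i J)
  then show ?thesis using inv by auto
qed

text \<open>
  A run can only get stuck where a minimal polynomial, a square-free part or a dimension is
  missing, and all of them exist under the invariant.
\<close>

lemma progress:
  fixes I :: "'a::field mpoly set"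
  assumes I: "zero_dimensional n I" "1 \<notin> I" and inv: "invariant n I c" and stuck: "\<nexists>c'. step n c c'"
  shows "\<exists>J. c = Return J"
proof (cases c)
  case (Start J)
  then obtain d where "quot_dim n J d" using I(1) inv by (auto simp: zero_dimensional_def)
  then show ?thesis using stuck Start step.init by blast
next
  case (Loop i J d)
  then have btw: "between n I J d" and "i \<ge> 1" using inv by auto
  interpret proper_ideal n J by (rule between_proper[OF btw I(2)])
  show ?thesis
  proof (cases "i \<le> n")
    case True
    then have "X i \<in> carrier R" using \<open>i \<ge> 1\<close> by simp
    moreover have "quot_dim n J d" using btw by (simp add: between_def)
    ultimately obtain \<mu> where "is_minpoly n (X i) J \<mu>" using exists_minpoly by blast
    then show ?thesis using stuck Loop True step.loop_minpoly by blast
  next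
    case False
    then show ?thesis using stuck Loop step.loop_end[of n i] by auto
  qed
next
  case (Test_Sqfree i J d \<mu>)
  then have i: "i \<in> {1..n}" and J: "between n I J d" and "\<mu> \<noteq> 0"
    and ker: "\<And>g. subst g (X i) \<in> J \<longleftrightarrow> \<mu> dvd g"
    using inv by auto
  have dim: "quot_dim n J d" and ideal: "ideal J (mpoly_ring n)" using J by (auto simp: between_def)
  define \<nu> where "\<nu> = smult 1 (\<Prod>{q. Factorial_Ring.irreducible q \<and> lead_coeff q = 1 \<and> q dvd \<mu>})"
  have \<nu>: "is_sqfree \<mu> \<nu>" unfolding is_sqfree_def \<nu>_def by (intro exI[of _ 1]) simp
  have x: "X i \<in> carrier (mpoly_ring n :: 'a mpoly ring)" and
    w: "subst \<nu> (X i) \<in> carrier (mpoly_ring n)" using i by simp_all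
  have "1 \<notin> adjoin n J (subst \<nu> (X i))"
    using between_adjoin[OF J w adjoin_sqfree_part(1)[OF ideal x ker \<open>\<mu> \<noteq> 0\<close> \<nu>]] I(2)
    by (auto simp: radical_mpoly_iff)
  then obtain d' where "quot_dim n (adjoin n J (subst \<nu> (X i))) d'"
    using quot_dim_superideal[OF dim ideal adjoin_properties(1,2)[OF ideal w]] by blast
  then have "\<exists>c'. step n c c'"
    using step.already_sqfree[of \<mu> n i J d] step.make_sqfree[OF _ \<nu> adjoin_def] Test_Sqfree by blast
  then show ?thesis using stuck by blast
next
  case (Test_Degree i J d \<mu>)
  then show ?thesis
    using stuck step.early_return[of \<mu> d n i J] step.loop_next[of \<mu> d n i J] by blast
qed auto

fun remaining_steps :: "nat \<Rightarrow> ('p, 'u) config \<Rightarrow> nat" where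
  "remaining_steps n (Start J) = 3 * n + 2"
| "remaining_steps n (Loop i J d) = 3 * (Suc n - i) + 1"
| "remaining_steps n (Test_Sqfree i J d \<mu>) = 3 * (n - i) + 3"
| "remaining_steps n (Test_Degree i J d \<mu>) = 3 * (n - i) + 2"
| "remaining_steps n (Return J) = 0"

lemma step_decreases: "step n c c' \<Longrightarrow> remaining_steps n c' < remaining_steps n c"
  by (induction rule: step.induct) (simp_all add: Suc_diff_le)

lemma terminates: "termip (step n) c"
proof (induction "remaining_steps n c" arbitrary: c rule: less_induct)
  case less
  show ?case by (rule accp.accI) (use less step_decreases in blast)
qed

theorem mainTheorem6:
  fixes n :: nat and I :: "'a::field mpoly set"
  assumes "perfect_field TYPE('a)"
    and "zero_dimensional n I"
  shows "termip (step n) (Start I) \<and>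
    (\<forall>c. (step n)\<^sup>*\<^sup>* (Start I) c \<and> (\<nexists>c'. step n c c') \<longrightarrow>
         c = Return (radical (mpoly_ring n) I))"
proof (intro conjI allI impI)
  show "termip (step n) (Start I)" by (rule terminates)
  fix c assume c: "(step n)\<^sup>*\<^sup>* (Start I) c \<and> (\<nexists>c'. step n c c')"
  have I: "ideal I (mpoly_ring n)" using assms(2) by (simp add: zero_dimensional_def)
  have "1 \<notin> I"
  proof
    assume "1 \<in> I"
    have mem: "f \<in> I" if "f \<in> carrier (mpoly_ring n)" for f
      using mpoly_idealD(4)[OF I that \<open>1 \<in> I\<close>] by simp
    have "carrier (mpoly_ring n Quot I) = {\<zero>\<^bsub>mpoly_ring n Quot I\<^esub>}"
      unfolding carrier_quot
      using quot_coset_eq_zero_iff[OF I] mem mpoly_zero_one_closed(1)[where 'a='a and n=n] by blast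
    then show False using assms(2) by (simp add: zero_dimensional_def)
  qed
  have "(step n)\<^sup>*\<^sup>* (Start I) c" using c by blast
  then have "invariant n I c"
  proof (induction rule: rtranclp_induct)
    case (step c c')
    then show ?case using invariant_step[OF assms(1) I \<open>1 \<notin> I\<close>] by blast
  qed simp
  moreover from this obtain J where "c = Return J"
    using progress[OF assms(2) \<open>1 \<notin> I\<close>] c by blast
  ultimately show "c = Return (radical (mpoly_ring n) I)" by simp
qed

end
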